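(* There is an algorithm that solves the Constrained $k$-near Chain Editing problem in time $O(n^3 k^{2k+2})$, where $n=|S|+|Q|$.
   Context: The input is a bipartite graph $G=(S\cup Q,E)$ (students $S$, questions $Q$; $sq\in E$ means student $s$ answered question $q$ correctly), a bijection $\alpha:S\to\{1,\dots,|S|\}$ (initial student ordering), a positive integer $k$, and a fixed bijection $\beta:Q\to\{1,\dots,|Q|\}$ (question ordering, from easiest to hardest). For a vertex $x$, $N(x)$ denotes its neighborhood. An ordering (bijection) $\pi:S\to\{1,\dots,|S|\}$ is nested if $\pi(s_1)\ge \pi(s_2)$ implies $N(s_1)\supseteq N(s_2)$. The ordering $\beta$ satisfies the interval property if for every $s\in S$, $N(s)=\{\beta^{-1}(1),\dots,\beta^{-1}(j)\}$ for some $j\in\{0,\dots,|Q|\}$. An edge edit is the addition or deletion of a student–question pair. The Constrained $k$-near Chain Editing problem asks for a minimum-size set of edge edits such that in the edited graph there is a nested student ordering $\pi$ with $\pi(s)\in[\alpha(s)-k,\alpha(s)+k]$ for all $s\in S$, and the given question ordering $\beta$ satisfies the interval property. *)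

theory Defs
  imports Main
begin

section \<open>The editing problem\<close>

text \<open>
  A bipartite graph on students \<open>S\<close> and questions \<open>Q\<close> is given by its edge set
  \<open>E \<subseteq> S \<times> Q\<close>.
\<close>

definition nbhd :: "('s \<times> 'q) set \<Rightarrow> 's \<Rightarrow> 'q set" where
  "nbhd E s = {q. (s, q) \<in> E}"

definition is_ordering :: "'a set \<Rightarrow> ('a \<Rightarrow> nat) \<Rightarrow> bool" where
  "is_ordering A f \<longleftrightarrow> bij_betw f A {1..card A}"

definition nested :: "'s set \<Rightarrow> ('s \<times> 'q) set \<Rightarrow> ('s \<Rightarrow> nat) \<Rightarrow> bool" where
  "nested S E \<pi> \<longleftrightarrow>
     (\<forall>s\<^sub>1\<in>S. \<forall>s\<^sub>2\<in>S. \<pi> s\<^sub>1 \<ge> \<pi> s\<^sub>2 \<longrightarrow> nbhd E s\<^sub>1 \<supseteq> nbhd E s\<^sub>2)"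

definition interval_property ::
    "'s set \<Rightarrow> 'q set \<Rightarrow> ('s \<times> 'q) set \<Rightarrow> ('q \<Rightarrow> nat) \<Rightarrow> bool" where
  "interval_property S Q E \<beta> \<longleftrightarrow>
     (\<forall>s\<in>S. \<exists>j\<in>{0..card Q}. nbhd E s = inv_into Q \<beta> ` {1..j})"

definition near :: "'s set \<Rightarrow> nat \<Rightarrow> ('s \<Rightarrow> nat) \<Rightarrow> ('s \<Rightarrow> nat) \<Rightarrow> bool" where
  "near S k \<alpha> \<pi> \<longleftrightarrow>
     (\<forall>s\<in>S. int (\<pi> s) \<in> {int (\<alpha> s) - int k .. int (\<alpha> s) + int k})"

text \<open>A set \<open>F\<close> of edits toggles the pairs it contains.\<close>

definition edited :: "('s \<times> 'q) set \<Rightarrow> ('s \<times> 'q) set \<Rightarrow> ('s \<times> 'q) set" where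
  "edited E F = (E - F) \<union> (F - E)"

definition feasible_edits ::
    "'s set \<Rightarrow> 'q set \<Rightarrow> ('s \<times> 'q) set \<Rightarrow> ('s \<Rightarrow> nat) \<Rightarrow> ('q \<Rightarrow> nat) \<Rightarrow> nat
      \<Rightarrow> ('s \<times> 'q) set \<Rightarrow> bool" where
  "feasible_edits S Q E \<alpha> \<beta> k F \<longleftrightarrow>
     F \<subseteq> S \<times> Q \<and>
     (\<exists>\<pi>. is_ordering S \<pi> \<and> nested S (edited E F) \<pi> \<and> near S k \<alpha> \<pi>) \<and>
     interval_property S Q (edited E F) \<beta>"

definition near_chain_instance ::
    "'s set \<Rightarrow> 'q set \<Rightarrow> ('s \<times> 'q) set \<Rightarrow> ('s \<Rightarrow> nat) \<Rightarrow> ('q \<Rightarrow> nat) \<Rightarrow> nat \<Rightarrow> bool" where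
  "near_chain_instance S Q E \<alpha> \<beta> k \<longleftrightarrow>
     finite S \<and> finite Q \<and> E \<subseteq> S \<times> Q \<and> is_ordering S \<alpha> \<and> is_ordering Q \<beta> \<and> k > 0"

definition near_chain_solution ::
    "'s set \<Rightarrow> 'q set \<Rightarrow> ('s \<times> 'q) set \<Rightarrow> ('s \<Rightarrow> nat) \<Rightarrow> ('q \<Rightarrow> nat) \<Rightarrow> nat
      \<Rightarrow> ('s \<times> 'q) set \<Rightarrow> bool" where
  "near_chain_solution S Q E \<alpha> \<beta> k F \<longleftrightarrow> is_arg_min card (feasible_edits S Q E \<alpha> \<beta> k) F"


section \<open>The machine model\<close>

text \<open>
  A random access machine with an unbounded memory of natural numbers, a read-only input
  tape and a write-only output tape, under the uniform cost criterion: every instruction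
  and every evaluation of a test takes one step. The only arithmetic is addition
  and truncated subtraction; unit-cost multiplication is deliberately left out, since it
  would make the uniform cost criterion unrealistic. Control flow is structured.
\<close>

type_synonym memory = "nat \<Rightarrow> nat"

datatype operand = Const nat | Cell nat | Indirect nat

fun val :: "memory \<Rightarrow> operand \<Rightarrow> nat" where
  "val M (Const c) = c"
| "val M (Cell i) = M i"
| "val M (Indirect i) = M (M i)"

datatype target = To_Cell nat | To_Indirect nat

fun address :: "memory \<Rightarrow> target \<Rightarrow> nat" where
  "address M (To_Cell i) = i"
| "address M (To_Indirect i) = M i"

datatype test = Less operand operand | Leq operand operand | Equal operand operand

fun holds :: "memory \<Rightarrow> test \<Rightarrow> bool" where
  "holds M (Less a b) \<longleftrightarrow> val M a < val M b"
| "holds M (Leq a b) \<longleftrightarrow> val M a \<le> val M b"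
| "holds M (Equal a b) \<longleftrightarrow> val M a = val M b"

datatype program =
    Skip
  | Move target operand
  | Add target operand operand
  | Sub target operand operand
  | Read target
  | Write operand
  | Seq program program
  | If test program program
  | While test program

text \<open>Memory, unread part of the input, output written so far.\<close>

type_synonym config = "memory \<times> nat list \<times> nat list"

text \<open>
  \<open>executes P c t c'\<close>: started in \<open>c\<close>, the program \<open>P\<close> halts in \<open>c'\<close> after exactly \<open>t\<close> steps.
  Reading past the end of the input gets stuck.
\<close>

inductive executes :: "program \<Rightarrow> config \<Rightarrow> nat \<Rightarrow> config \<Rightarrow> bool" where
  Skip: "executes Skip c 1 c"
| Move: "executes (Move d a) (M, inp, out) 1 (M(address M d := val M a), inp, out)"
| Add: "executes (Add d a b) (M, inp, out) 1 (M(address M d := val M a + val M b), inp, out)"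
| Sub: "executes (Sub d a b) (M, inp, out) 1 (M(address M d := val M a - val M b), inp, out)"
| Read: "executes (Read d) (M, x # inp, out) 1 (M(address M d := x), inp, out)"
| Write: "executes (Write a) (M, inp, out) 1 (M, inp, out @ [val M a])"
| Seq: "executes P c t c' \<Longrightarrow> executes R c' u c'' \<Longrightarrow> executes (Seq P R) c (t + u) c''"
| If_True: "holds (fst c) b \<Longrightarrow> executes P c t c' \<Longrightarrow> executes (If b P R) c (1 + t) c'"
| If_False: "\<not> holds (fst c) b \<Longrightarrow> executes R c t c' \<Longrightarrow> executes (If b P R) c (1 + t) c'"
| While_False: "\<not> holds (fst c) b \<Longrightarrow> executes (While b P) c 1 c"
| While_True: "holds (fst c) b \<Longrightarrow> executes P c t c' \<Longrightarrow> executes (While b P) c' u c'' \<Longrightarrow>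
    executes (While b P) c (1 + t + u) c''"

lemma executes_deterministic:
  "executes P c t c' \<Longrightarrow> executes P c u d \<Longrightarrow> u = t \<and> d = c'"
proof (induction arbitrary: u d rule: executes.induct)
  case (Skip c)
  from Skip.prems show ?case by cases simp_all
next
  case (Move d a M inp out)
  from Move.prems show ?case by cases simp_all
next
  case (Add d a b M inp out)
  from Add.prems show ?case by cases simp_all
next
  case (Sub d a b M inp out)
  from Sub.prems show ?case by cases simp_all
next
  case (Read d M x inp out)
  from Read.prems show ?case by cases simp_all
next
  case (Write a M inp out)
  from Write.prems show ?case by cases simp_all
next
  case (Seq P c t c' R v c'')
  from Seq.prems obtain t1 t2 e
    where e: "executes P c t1 e" "executes R e t2 d" "u = t1 + t2"
    by cases simp
  with Seq.IH(1)[OF e(1)] Seq.IH(2)[of t2 d] show ?case by simp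
next
  case (If_True c b P t c' R)
  from If_True.prems obtain t1 where e: "executes P c t1 d" "u = 1 + t1"
    by cases (use If_True.hyps(1) in simp_all)
  with If_True.IH[OF e(1)] show ?case by simp
next
  case (If_False c b R t c' P)
  from If_False.prems obtain t1 where e: "executes R c t1 d" "u = 1 + t1"
    by cases (use If_False.hyps(1) in simp_all)
  with If_False.IH[OF e(1)] show ?case by simp
next
  case (While_False c b P)
  from While_False.prems show ?case
    by cases (use While_False.hyps(1) in simp_all)
next
  case (While_True c b P t c' v c'')
  from While_True.prems obtain t1 t2 e
    where e: "executes P c t1 e" "executes (While b P) e t2 d" "u = 1 + t1 + t2"
    by cases (use While_True.hyps(1) in simp_all)
  with While_True.IH(1)[OF e(1)] While_True.IH(2)[of t2 d] show ?case by simp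
qed

text \<open>The memory is initially zero.\<close>

definition runs :: "program \<Rightarrow> nat list \<Rightarrow> nat \<Rightarrow> nat list \<Rightarrow> bool" where
  "runs P inp t out \<longleftrightarrow> (\<exists>M rest. executes P (\<lambda>_. 0, inp, []) t (M, rest, out))"


section \<open>Encoding of inputs and outputs\<close>

text \<open>
  The \<open>m\<close> students and \<open>p\<close> questions are named \<open>0, \<dots>, m - 1\<close> and \<open>0, \<dots>, p - 1\<close>. The input
  consists of \<open>m\<close>, \<open>p\<close>, \<open>k\<close>, the two orderings, and the adjacency matrix row by row.
\<close>

definition encode_input ::
    "nat \<Rightarrow> nat \<Rightarrow> (nat \<times> nat) set \<Rightarrow> (nat \<Rightarrow> nat) \<Rightarrow> (nat \<Rightarrow> nat) \<Rightarrow> nat \<Rightarrow> nat list" where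
  "encode_input m p E \<alpha> \<beta> k =
     [m, p, k] @ map \<alpha> [0..<m] @ map \<beta> [0..<p] @
     concat (map (\<lambda>s. map (\<lambda>q. of_bool ((s, q) \<in> E)) [0..<p]) [0..<m])"

text \<open>A set of pairs is output as a list of its elements, in any order but without repetition.\<close>

definition encodes_output :: "nat list \<Rightarrow> (nat \<times> nat) set \<Rightarrow> bool" where
  "encodes_output out F \<longleftrightarrow>
     (\<exists>fs. distinct fs \<and> set fs = F \<and> out = concat (map (\<lambda>(s, q). [s, q]) fs))"

end

theory Submission
  imports Defs "HOL-Library.Extended_Nat"
begin

text \<open>
  Let student \<open>s\<close> own the slot \<open>\<alpha> s + k - 1\<close>, and regard the slots below \<open>k\<close> as taken from the
  start. Then \<open>\<pi>\<close> is near \<open>\<alpha>\<close> iff for each \<open>i\<close> the student at position \<open>i + 1\<close> owns one of the slots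
  \<open>i, \<dots>, i + 2 k\<close>. If the positions are filled from left to right, all slots below \<open>i\<close> have
  to be taken once \<open>i\<close> positions are filled, and no slot from \<open>i + 2 k\<close> on can be taken; so the set of
  taken slots is a mask of \<open>2 k\<close> bits. The interval property reduces the neighbourhood of a
  student to a level in \<open>{0..p}\<close>, and nestedness says that the levels do not decrease along \<open>\<pi>\<close>. A
  dynamic program over triples \<open>(i, j, x)\<close> of the number of filled positions, the level and the mask,
  whose moves raise the level or fill the next position, therefore finds an optimal solution. It has
  \<open>O(m p 4\<^sup>k)\<close> nodes with \<open>O(k)\<close> moves each. As \<open>16\<^sup>k = O(k\<^sup>2\<^sup>k)\<close>, a move may take time
  \<open>O(p + 4\<^sup>k)\<close>, which makes it affordable to halve masks by repeated subtraction and to recount the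
  edits of a student every time.
\<close>

section \<open>A weakest precondition calculus with a clock\<close>

type_synonym assertion = "memory \<Rightarrow> nat list \<Rightarrow> nat list \<Rightarrow> nat \<Rightarrow> bool"

text \<open>The last argument of an assertion is a clock, which counts the steps executed so far.\<close>

definition wp :: "program \<Rightarrow> assertion \<Rightarrow> assertion" where
  "wp P Q M inp out t \<longleftrightarrow>
     (\<exists>u M' inp' out'. executes P (M, inp, out) u (M', inp', out') \<and> Q M' inp' out' (t + u))"

lemma executes_iffs:
  "executes Skip c u c' \<longleftrightarrow> u = 1 \<and> c' = c"
  "executes (Move d a) (M, inp, out) u c' \<longleftrightarrow> u = 1 \<and> c' = (M(address M d := val M a), inp, out)"
  "executes (Add d a b) (M, inp, out) u c' \<longleftrightarrow>
     u = 1 \<and> c' = (M(address M d := val M a + val M b), inp, out)"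
  "executes (Sub d a b) (M, inp, out) u c' \<longleftrightarrow>
     u = 1 \<and> c' = (M(address M d := val M a - val M b), inp, out)"
  "executes (Read d) (M, x # inp, out) u c' \<longleftrightarrow> u = 1 \<and> c' = (M(address M d := x), inp, out)"
  "executes (Write a) (M, inp, out) u c' \<longleftrightarrow> u = 1 \<and> c' = (M, inp, out @ [val M a])"
  "executes (Seq P R) c u c' \<longleftrightarrow>
     (\<exists>v w c''. u = v + w \<and> executes P c v c'' \<and> executes R c'' w c')"
  "executes (If e P R) c u c' \<longleftrightarrow>
     (\<exists>v. u = 1 + v \<and> executes (if holds (fst c) e then P else R) c v c')"
  by (subst executes.simps; force)+

lemma wp_atomic:
  "wp Skip Q M inp out t = Q M inp out (t + 1)"
  "wp (Move d a) Q M inp out t = Q (M(address M d := val M a)) inp out (t + 1)"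
  "wp (Add d a b) Q M inp out t = Q (M(address M d := val M a + val M b)) inp out (t + 1)"
  "wp (Sub d a b) Q M inp out t = Q (M(address M d := val M a - val M b)) inp out (t + 1)"
  "wp (Read d) Q M (x # inp) out t = Q (M(address M d := x)) inp out (t + 1)"
  "wp (Write a) Q M inp out t = Q M inp (out @ [val M a]) (t + 1)"
  by (simp_all add: wp_def executes_iffs)

lemma wp_Seq: "wp (Seq P R) Q = wp P (wp R Q)"
proof (intro ext iffI)
  fix M inp out t
  assume "wp (Seq P R) Q M inp out t"
  then obtain u v M' inp' out' M'' inp'' out'' where
    "executes P (M, inp, out) u (M', inp', out')" "executes R (M', inp', out') v (M'', inp'', out'')"
    "Q M'' inp'' out'' (t + u + v)"
    by (auto simp: wp_def executes_iffs add.assoc)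
  then show "wp P (wp R Q) M inp out t" unfolding wp_def by blast
next
  fix M inp out t
  assume "wp P (wp R Q) M inp out t"
  then obtain u v M' inp' out' M'' inp'' out'' where
    "executes P (M, inp, out) u (M', inp', out')" "executes R (M', inp', out') v (M'', inp'', out'')"
    "Q M'' inp'' out'' (t + (u + v))"
    by (auto simp: wp_def add.assoc)
  then show "wp (Seq P R) Q M inp out t" unfolding wp_def by (blast intro: executes.Seq)
qed

lemma wp_If:
  "wp (If b P R) Q M inp out t = wp (if holds M b then P else R) Q M inp out (t + 1)"
  unfolding wp_def executes_iffs fst_conv add.assoc by blast

lemma wp_While_False:
  "\<not> holds M b \<Longrightarrow> Q M inp out (t + 1) \<Longrightarrow> wp (While b P) Q M inp out t"
  unfolding wp_def by (metis executes.While_False fst_conv)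

lemma wp_While_True:
  assumes "holds M b" "wp P (wp (While b P) Q) M inp out (t + 1)"
  shows "wp (While b P) Q M inp out t"
proof -
  from assms(2) obtain u v M' inp' out' M'' inp'' out'' where
    runs: "executes P (M, inp, out) u (M', inp', out')"
      "executes (While b P) (M', inp', out') v (M'', inp'', out'')"
    and post: "Q M'' inp'' out'' (t + (1 + u + v))" by (auto simp: wp_def add.assoc)
  have "executes (While b P) (M, inp, out) (1 + u + v) (M'', inp'', out'')"
    by (rule executes.While_True[OF _ runs]) (use assms(1) in simp)
  with post show ?thesis unfolding wp_def by blast
qed

lemma wp_mono:
  "wp P Q M inp out t \<Longrightarrow> (\<And>M' inp' out' t'. Q M' inp' out' t' \<Longrightarrow> R M' inp' out' t') \<Longrightarrow>
    wp P R M inp out t"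
  unfolding wp_def by blast

abbreviation (input) timely :: "(memory \<Rightarrow> nat list \<Rightarrow> nat list \<Rightarrow> bool) \<Rightarrow> nat \<Rightarrow> assertion" where
  "timely J u \<equiv> \<lambda>M inp out t. J M inp out \<and> t \<le> u"

lemma wp_While:
  fixes I :: "nat \<Rightarrow> memory \<Rightarrow> nat list \<Rightarrow> nat list \<Rightarrow> bool"
  assumes init: "I 0 M inp out"
    and step: "\<And>i M' inp' out' t'. i < n \<Longrightarrow> I i M' inp' out' \<Longrightarrow>
      holds M' b \<and> wp P (timely (I (Suc i)) (t' + c)) M' inp' out' t'"
    and exit: "\<And>M' inp' out' t'. I n M' inp' out' \<Longrightarrow> t' \<le> t + (c + 1) * n + 1 \<Longrightarrow>
      \<not> holds M' b \<and> Q M' inp' out' t'"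
  shows "wp (While b P) Q M inp out t"
proof -
  have "wp (While b P) Q M' inp' out' t'"
    if "i \<le> n" "I i M' inp' out'" "t' \<le> t + (c + 1) * i" for i M' inp' out' t'
    using that
  proof (induction "n - i" arbitrary: i M' inp' out' t')
    case 0
    then show ?case using exit by (intro wp_While_False) auto
  next
    case (Suc d)
    then have "i < n" by simp
    from step[OF this Suc.prems(2), of "t' + 1"] show ?case
    proof (elim conjE, intro wp_While_True)
      assume "wp P (timely (I (Suc i)) (t' + 1 + c)) M' inp' out' (t' + 1)"
      then show "wp P (wp (While b P) Q) M' inp' out' (t' + 1)"
      proof (rule wp_mono, elim conjE)
        fix M'' inp'' out'' t''
        assume "I (Suc i) M'' inp'' out''" "t'' \<le> t' + 1 + c"
        with Suc.hyps(1)[of "Suc i"] Suc.hyps(2) Suc.prems(3) \<open>i < n\<close>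
        show "wp (While b P) Q M'' inp'' out'' t''" by (simp add: algebra_simps)
      qed
    qed
  qed
  from this[of 0] init show ?thesis by simp
qed

lemmas wp_basic = wp_atomic wp_Seq wp_If

fun block :: "program list \<Rightarrow> program" where
  "block [] = Skip"
| "block [P] = P"
| "block (P # Ps) = Seq P (block Ps)"

definition for_up :: "nat \<Rightarrow> nat \<Rightarrow> program \<Rightarrow> program" where
  "for_up r l P = block
     [Move (To_Cell r) (Const 0),
      While (Less (Cell r) (Cell l)) (Seq P (Add (To_Cell r) (Cell r) (Const 1)))]"

lemma wp_for_up:
  fixes I :: "nat \<Rightarrow> memory \<Rightarrow> nat list \<Rightarrow> nat list \<Rightarrow> bool"
  assumes "r \<noteq> l"
    and init: "I 0 (M(r := 0)) inp out"
    and step: "\<And>i M' inp' out' t'. i < M l \<Longrightarrow> M' r = i \<Longrightarrow> I i M' inp' out' \<Longrightarrow>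
      wp P (timely (\<lambda>M'' inp'' out''. M'' r = i \<and> M'' l = M' l \<and> I (Suc i) (M''(r := Suc i)) inp'' out'')
        (t' + c)) M' inp' out' t'"
    and exit: "\<And>M' inp' out' t'. M' r = M l \<Longrightarrow> I (M l) M' inp' out' \<Longrightarrow>
      t' \<le> t + (c + 2) * M l + 2 \<Longrightarrow> Q M' inp' out' t'"
  shows "wp (for_up r l P) Q M inp out t"
  unfolding for_up_def block.simps wp_basic address.simps val.simps
proof (rule wp_While[where n = "M l" and c = "c + 1" and
      I = "\<lambda>i M' inp' out'. M' r = i \<and> M' l = M l \<and> I i M' inp' out'"])
  fix i M' inp' out' t'
  assume "i < M l" and inv: "M' r = i \<and> M' l = M l \<and> I i M' inp' out'"
  let ?body = "Seq P (Add (To_Cell r) (Cell r) (Const 1))"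
  let ?post = "timely (\<lambda>M'' inp'' out''. M'' r = Suc i \<and> M'' l = M l \<and> I (Suc i) M'' inp'' out'')
    (t' + (c + 1))"
  have "wp ?body ?post M' inp' out' t'"
    unfolding wp_Seq
    by (rule wp_mono[OF step[of i]]) (use inv \<open>i < M l\<close> \<open>r \<noteq> l\<close> in \<open>auto simp: wp_basic\<close>)
  then show "holds M' (Less (Cell r) (Cell l)) \<and> wp ?body ?post M' inp' out' t'"
    using inv \<open>i < M l\<close> by simp
qed (use \<open>r \<noteq> l\<close> init in \<open>auto intro!: exit\<close>)

definition for_down :: "nat \<Rightarrow> program \<Rightarrow> program" where
  "for_down r P = While (Less (Const 0) (Cell r)) (Seq (Sub (To_Cell r) (Cell r) (Const 1)) P)"

lemma wp_for_down:
  fixes I :: "nat \<Rightarrow> memory \<Rightarrow> nat list \<Rightarrow> nat list \<Rightarrow> bool"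
  assumes init: "I (M r) M inp out"
    and step: "\<And>i M' inp' out' t'. i < M r \<Longrightarrow> M' r = Suc i \<Longrightarrow> I (Suc i) M' inp' out' \<Longrightarrow>
      wp P (timely (\<lambda>M'' inp'' out''. M'' r = i \<and> I i M'' inp'' out'') (t' + c)) (M'(r := i)) inp' out' t'"
    and exit: "\<And>M' inp' out' t'. I 0 M' inp' out' \<Longrightarrow>
      t' \<le> t + (c + 2) * M r + 1 \<Longrightarrow> Q M' inp' out' t'"
  shows "wp (for_down r P) Q M inp out t"
  unfolding for_down_def
proof (rule wp_While[where n = "M r" and c = "c + 1" and
      I = "\<lambda>i M' inp' out'. M' r = M r - i \<and> I (M r - i) M' inp' out'"])
  fix i M' inp' out' t'
  assume "i < M r" and inv: "M' r = M r - i \<and> I (M r - i) M' inp' out'"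
  define d where "d = M r - Suc i"
  have countdown: "M r - i = Suc d" "M r - Suc i = d" "d < M r" using \<open>i < M r\<close> by (auto simp: d_def)
  let ?body = "Seq (Sub (To_Cell r) (Cell r) (Const 1)) P"
  let ?post = "\<lambda>d. timely (\<lambda>M'' inp'' out''. M'' r = d \<and> I d M'' inp'' out'') (t' + (c + 1))"
  have "wp ?body (?post d) M' inp' out' t'"
    using step[of d M' inp' out' "t' + 1"] inv countdown by (simp add: wp_basic)
  then show "holds M' (Less (Const 0) (Cell r)) \<and> wp ?body (?post (M r - Suc i)) M' inp' out' t'"
    using inv countdown by simp
qed (use init in \<open>auto intro!: exit\<close>)

text \<open>The memory is split into registers, the cells below 32, and eight arrays that are
  interleaved in the remaining cells and hence unbounded. Cell 0 is reserved for computed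
  addresses.\<close>

definition arr :: "nat \<Rightarrow> memory \<Rightarrow> nat \<Rightarrow> nat" where
  "arr a M e = M (32 + 8 * e + a)"

definition upd :: "nat \<Rightarrow> nat \<Rightarrow> nat \<Rightarrow> memory \<Rightarrow> memory" where
  "upd a e v M = M(32 + 8 * e + a := v)"

definition locate :: "nat \<Rightarrow> nat \<Rightarrow> program" where
  "locate a e = block
     [Add (To_Cell 0) (Cell e) (Cell e),
      Add (To_Cell 0) (Cell 0) (Cell 0),
      Add (To_Cell 0) (Cell 0) (Cell 0),
      Add (To_Cell 0) (Cell 0) (Const (32 + a))]"

definition load :: "nat \<Rightarrow> nat \<Rightarrow> nat \<Rightarrow> program" where
  "load r a e = Seq (locate a e) (Move (To_Cell r) (Indirect 0))"

definition store :: "nat \<Rightarrow> nat \<Rightarrow> nat \<Rightarrow> program" where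
  "store a e r = Seq (locate a e) (Move (To_Indirect 0) (Cell r))"

lemma arr_reg [simp]: "r < 32 \<Longrightarrow> arr a (M(r := v)) = arr a M"
  by (auto simp: arr_def fun_eq_iff)

lemma upd_reg [simp]: "r < 32 \<Longrightarrow> upd a e v M r = M r"
  by (auto simp: upd_def)

lemma arr_upd [simp]:
  assumes "a < 8" "a' < 8"
  shows "arr a (upd a' e v M) = (if a = a' then (arr a M)(e := v) else arr a M)"
proof -
  have "a = a' \<and> e' = e" if "32 + 8 * e' + a = 32 + 8 * e + a'" for e'
  proof -
    have "(8 * e' + a) mod 8 = (8 * e + a') mod 8" using that by simp
    then show ?thesis using assms that by simp
  qed
  then show ?thesis by (auto simp: arr_def upd_def fun_eq_iff)
qed

lemma wp_load:
  "e \<noteq> 0 \<Longrightarrow> wp (load r a e) Q M inp out t =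
    Q (M(0 := 32 + 8 * M e + a, r := arr a M (M e))) inp out (t + 5)"
  by (simp add: load_def locate_def wp_basic arr_def ac_simps eval_nat_numeral)

lemma wp_store:
  "e \<noteq> 0 \<Longrightarrow> r \<noteq> 0 \<Longrightarrow> wp (store a e r) Q M inp out t =
    Q (upd a (M e) (M r) (M(0 := 32 + 8 * M e + a))) inp out (t + 5)"
  by (simp add: store_def locate_def wp_basic upd_def ac_simps eval_nat_numeral)

lemmas wp_simps = wp_basic wp_load wp_store

definition frame :: "nat set \<Rightarrow> memory \<Rightarrow> memory \<Rightarrow> bool" where
  "frame X M M' \<longleftrightarrow> (\<forall>r. r \<notin> X \<longrightarrow> M' r = M r)"

lemma frame_get: "frame X M M' \<Longrightarrow> r \<notin> X \<Longrightarrow> M' r = M r"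
  by (simp add: frame_def)

lemma frame_arr: "frame X M M' \<Longrightarrow> X \<subseteq> {..<32} \<Longrightarrow> arr a M' = arr a M"
  by (auto simp: frame_def arr_def fun_eq_iff)

lemma frame_refl [simp]: "frame X M M"
  by (simp add: frame_def)

lemma frame_upd [simp]: "r \<in> X \<Longrightarrow> frame X M (M'(r := v)) \<longleftrightarrow> frame X M M'"
  by (auto simp: frame_def)

lemma frame_mono: "frame X M M' \<Longrightarrow> X \<subseteq> Y \<Longrightarrow> frame Y M M'"
  by (auto simp: frame_def)

lemma frame_trans: "frame X M M' \<Longrightarrow> frame Y M' M'' \<Longrightarrow> X \<union> Y \<subseteq> Z \<Longrightarrow> frame Z M M''"
  unfolding frame_def by (metis UnI1 UnI2 subsetD)

section \<open>The dynamic program\<close>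

definition admissible :: "nat \<Rightarrow> nat \<Rightarrow> bool" where
  "admissible x b \<longleftrightarrow> \<not> bit x b \<and> bit (set_bit b x) 0"

definition occupy :: "nat \<Rightarrow> nat \<Rightarrow> nat" where
  "occupy x b = drop_bit 1 (set_bit b x)"

definition taken :: "nat \<Rightarrow> nat \<Rightarrow> nat set" where
  "taken i x = (+) i ` {b. bit x b}"

lemma mem_taken_iff: "t \<in> taken i x \<longleftrightarrow> i \<le> t \<and> bit x (t - i)"
  by (force simp: taken_def image_iff le_iff_add)

lemma taken_occupy: "taken (Suc i) (occupy x b) = insert (i + b) (taken i x) - {i}"
proof (rule set_eqI)
  fix t
  show "t \<in> taken (Suc i) (occupy x b) \<longleftrightarrow> t \<in> insert (i + b) (taken i x) - {i}"
  proof (cases "i < t")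
    case True
    then obtain c where "t = Suc i + c" using less_imp_Suc_add by auto
    then show ?thesis by (auto simp: mem_taken_iff occupy_def bit_simps)
  next
    case False
    then show ?thesis by (auto simp: mem_taken_iff)
  qed
qed

lemma admissible_iff: "admissible x b \<longleftrightarrow> i + b \<notin> taken i x \<and> i \<in> insert (i + b) (taken i x)"
  by (auto simp: admissible_def mem_taken_iff bit_simps)

lemma taken_eq_iff: "taken i x = {i..<i + k} \<longleftrightarrow> x = mask k"
proof -
  have "{i..<i + k} = (+) i ` {..<k}" by (simp add: lessThan_atLeast0 add.commute)
  then have "taken i x = {i..<i + k} \<longleftrightarrow> {b. bit x b} = {..<k}"
    by (simp add: taken_def inj_image_eq_iff)
  then show ?thesis by (auto simp: bit_eq_iff bit_mask_iff set_eq_iff)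
qed

lemma occupy_less:
  assumes "x < 2 ^ (2 * k)" "b \<le> 2 * k"
  shows "occupy x b < 2 ^ (2 * k)"
proof -
  have "take_bit (2 * k) x = x" using assms(1) by (simp add: take_bit_nat_eq_self)
  then have "c < 2 * k" if "bit x c" for c
    using bit_take_bit_iff[of "2 * k" x c] that by simp
  then have "take_bit (2 * k) (occupy x b) = occupy x b"
    using assms(2) by (intro bit_eqI) (auto simp: occupy_def bit_simps dest: Suc_lessD)
  then show ?thesis by (simp add: take_bit_nat_eq_self_iff)
qed

locale schedule =
  fixes m p k :: nat and cost :: "nat \<Rightarrow> nat \<Rightarrow> nat"
begin

text \<open>A schedule lists the slots and levels of the students from the first position to the last.
  Slots that belong to no student need not be excluded: once one of them is taken, the final mask
  is out of reach.\<close>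

fun fills :: "nat \<Rightarrow> nat \<Rightarrow> nat list \<Rightarrow> bool" where
  "fills i x [] \<longleftrightarrow> i = m \<and> x = mask k"
| "fills i x (t # ts) \<longleftrightarrow>
     (\<exists>b\<le>2 * k. t = i + b \<and> admissible x b \<and> fills (Suc i) (occupy x b) ts)"

definition in_windows :: "nat \<Rightarrow> nat list \<Rightarrow> bool" where
  "in_windows i ts \<longleftrightarrow> (\<forall>r<length ts. ts ! r \<in> {i + r..i + r + 2 * k})"

lemma in_windows_Cons: "in_windows i (t # ts) \<longleftrightarrow> t \<in> {i..i + 2 * k} \<and> in_windows (Suc i) ts"
  by (auto simp: in_windows_def nth_Cons split: nat.splits)

lemma in_windows_imp_ge: "in_windows i ts \<Longrightarrow> t \<in> set ts \<Longrightarrow> i \<le> t"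
  by (force simp: in_windows_def in_set_conv_nth)

lemma fills_iff:
  "fills i x ts \<longleftrightarrow>
     i + length ts = m \<and> distinct ts \<and> in_windows i ts \<and>
     taken i x \<subseteq> {i..<m + k} \<and> set ts = {i..<m + k} - taken i x"
proof (induction ts arbitrary: i x)
  case Nil
  have "taken m x \<subseteq> {m..<m + k} \<and> {m..<m + k} \<subseteq> taken m x \<longleftrightarrow> x = mask k"
    by (simp add: set_eq_subset flip: taken_eq_iff[of m])
  then show ?case by (auto simp: in_windows_def)
next
  case (Cons t ts)
  have extend: "i \<in> insert t U \<and> insert t U - {i} \<subseteq> N - {i} \<and> A = (N - {i}) - (insert t U - {i}) \<longleftrightarrow>
      t \<notin> A \<and> U \<subseteq> N \<and> insert t A = N - U"
    if "t \<notin> U" "i \<in> N" "i \<notin> A" for U A N :: "nat set"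
    using that by blast
  show ?case
  proof (cases "in_windows i (t # ts) \<and> t \<notin> taken i x \<and> i < m")
    case True
    then obtain b where slot: "t = i + b" "b \<le> 2 * k" "in_windows (Suc i) ts"
      by (auto simp: in_windows_Cons le_iff_add)
    have rest: "{Suc i..<m + k} = {i..<m + k} - {i}" by auto
    have "i \<in> {i..<m + k}" "i \<notin> set ts" using in_windows_imp_ge[OF slot(3), of i] True by auto
    then show ?thesis
      using extend[of "taken i x" "{i..<m + k}" "set ts"] True slot
      by (simp add: Cons.IH taken_occupy admissible_iff[of x _ i] rest) blast
  next
    case False
    then have "\<not> fills i x (t # ts)"
      by (auto simp: Cons.IH in_windows_Cons admissible_iff[of x _ i])
    with False show ?thesis by auto
  qed
qed

definition completes :: "nat \<Rightarrow> nat \<Rightarrow> nat \<Rightarrow> (nat \<times> nat) list \<Rightarrow> bool" where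
  "completes i j x T \<longleftrightarrow> fills i x (map fst T) \<and> sorted (j # map snd T) \<and> (\<forall>l\<in>snd ` set T. l \<le> p)"

lemma completes_Nil: "completes i j x [] \<longleftrightarrow> i = m \<and> x = mask k"
  by (simp add: completes_def)

lemma completes_Cons:
  "completes i j x ((t, l) # T) \<longleftrightarrow> j \<le> l \<and> l \<le> p \<and>
     (\<exists>b\<le>2 * k. t = i + b \<and> admissible x b \<and> completes (Suc i) l (occupy x b) T)"
  by (auto simp: completes_def)

lemma completes_antimono: "completes i j x T \<Longrightarrow> j' \<le> j \<Longrightarrow> completes i j' x T"
  by (auto simp: completes_def)

definition total :: "(nat \<times> nat) list \<Rightarrow> nat" where
  "total T = (\<Sum>(t, l)\<leftarrow>T. cost t l)"

definition opt :: "nat \<Rightarrow> nat \<Rightarrow> nat \<Rightarrow> enat" where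
  "opt i j x = (INF T\<in>{T. completes i j x T}. enat (total T))"

lemma opt_le_total: "completes i j x T \<Longrightarrow> opt i j x \<le> enat (total T)"
  by (auto simp: opt_def intro: INF_lower)

lemma opt_attained:
  assumes "opt i j x \<noteq> \<infinity>"
  obtains T where "completes i j x T" "opt i j x = enat (total T)"
proof -
  let ?V = "(\<lambda>T. enat (total T)) ` {T. completes i j x T}"
  have "?V \<noteq> {}" using assms unfolding opt_def by (metis Inf_empty top_enat_def)
  then have "Inf ?V \<in> ?V" unfolding Inf_enat_def by (auto intro: LeastI)
  then show thesis using that by (auto simp: opt_def)
qed

lemma opt_beyond:
  assumes "i = Suc m \<or> j = Suc p"
  shows "opt i j x = (if i = m \<and> x = mask k then 0 else \<infinity>)"
proof -
  have "\<not> completes i j x (a # T)" for a T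
    using assms by (cases a) (auto simp: completes_def fills_iff)
  then have "completes i j x T \<longleftrightarrow> T = [] \<and> i = m \<and> x = mask k" for T
    by (cases T) (simp_all add: completes_Nil)
  then have "{T. completes i j x T} = (if i = m \<and> x = mask k then {[]} else {})" by auto
  then show ?thesis by (simp add: opt_def total_def zero_enat_def flip: top_enat_def)
qed

text \<open>Move 0 raises the level, and move \<open>b + 1\<close> fills the next position with slot \<open>i + b\<close>.\<close>

fun move_value :: "nat \<Rightarrow> nat \<Rightarrow> nat \<Rightarrow> nat \<Rightarrow> enat" where
  "move_value i j x 0 = opt i (Suc j) x"
| "move_value i j x (Suc b) =
     (if admissible x b then opt (Suc i) j (occupy x b) + cost (i + b) j else \<infinity>)"

lemma opt_le_move_value:
  assumes "c \<le> 2 * k + 1" "j \<le> p"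
  shows "opt i j x \<le> move_value i j x c"
proof (cases "move_value i j x c = \<infinity>")
  case False
  show ?thesis
  proof (cases c)
    case 0
    with False obtain T where "completes i (Suc j) x T" "move_value i j x c = enat (total T)"
      using opt_attained[of i "Suc j" x] by auto
    then show ?thesis using opt_le_total completes_antimono[of i "Suc j" x T j] by simp
  next
    case (Suc b)
    with False have admissible: "admissible x b" and "opt (Suc i) j (occupy x b) \<noteq> \<infinity>"
      by (auto simp: plus_eq_infty_iff_enat simp del: not_infinity_eq split: if_splits)
    then obtain T where attained: "completes (Suc i) j (occupy x b) T"
      "opt (Suc i) j (occupy x b) = enat (total T)"
      by (elim opt_attained)
    then have "completes i j x ((i + b, j) # T)" using assms Suc admissible by (auto simp: completes_Cons)
    from opt_le_total[OF this] show ?thesis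
      using Suc admissible attained(2) by (simp add: total_def add.commute)
  qed
qed simp

lemma move_value_le_total:
  assumes "completes i j x T" "j \<le> p"
  obtains c where "c \<le> 2 * k + 1" "move_value i j x c \<le> enat (total T)"
proof (cases "completes i (Suc j) x T")
  case True
  then show thesis using that[of 0] opt_le_total by simp
next
  case False
  obtain b T' where slot: "b \<le> 2 * k" "T = (i + b, j) # T'" "admissible x b"
    and rest: "completes (Suc i) j (occupy x b) T'"
  proof (cases T)
    case Nil
    with False assms show thesis by (simp add: completes_Nil)
  next
    case (Cons a T')
    with that False assms show thesis
      by (cases a) (auto simp: completes_Cons not_less_eq_eq)
  qed
  show thesis
  proof (rule that)
    show "Suc b \<le> 2 * k + 1" using slot(1) by simp
    have "opt (Suc i) j (occupy x b) + enat (cost (i + b) j) \<le> enat (total T') + enat (cost (i + b) j)"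
      using opt_le_total[OF rest] by (rule add_right_mono)
    then show "move_value i j x (Suc b) \<le> enat (total T)"
      using slot by (simp add: total_def add.commute)
  qed
qed

lemma opt_eq_move_value:
  assumes "is_arg_min (move_value i j x) (\<lambda>c. c \<le> 2 * k + 1) c" "j \<le> p"
  shows "opt i j x = move_value i j x c"
proof (rule antisym)
  show "opt i j x \<le> move_value i j x c"
    using assms by (intro opt_le_move_value) (simp_all add: is_arg_min_linorder)
  show "move_value i j x c \<le> opt i j x"
  proof (cases "opt i j x = \<infinity>")
    case False
    then obtain T where attained: "completes i j x T" "opt i j x = enat (total T)" by (rule opt_attained)
    obtain c' where "c' \<le> 2 * k + 1" "move_value i j x c' \<le> enat (total T)"
      using attained(1) assms(2) by (rule move_value_le_total)
    with assms(1) attained(2) show ?thesis by (auto simp: is_arg_min_linorder intro: order.trans)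
  qed simp
qed

definition optimal_prefix :: "(nat \<times> nat) list \<Rightarrow> nat \<Rightarrow> nat \<Rightarrow> nat \<Rightarrow> bool" where
  "optimal_prefix T i j x \<longleftrightarrow> opt 0 0 (mask k) = enat (total T) + opt i j x \<and>
     (\<forall>T'. completes i j x T' \<longrightarrow> completes 0 0 (mask k) (T @ T'))"

lemma optimal_prefix_Nil: "optimal_prefix [] 0 0 (mask k)"
  by (simp add: optimal_prefix_def total_def flip: zero_enat_def)

lemma optimal_prefix_raise:
  "optimal_prefix T i j x \<Longrightarrow> opt i j x = move_value i j x 0 \<Longrightarrow> optimal_prefix T i (Suc j) x"
  using completes_antimono[of i "Suc j" x _ j] by (simp add: optimal_prefix_def)

lemma optimal_prefix_place:
  assumes "optimal_prefix T i j x" "opt i j x = move_value i j x (Suc b)" "opt i j x \<noteq> \<infinity>"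
    and "b \<le> 2 * k" "j \<le> p"
  shows "optimal_prefix (T @ [(i + b, j)]) (Suc i) j (occupy x b)"
proof -
  have admissible: "admissible x b" using assms(2,3) by (auto split: if_splits)
  have "completes 0 0 (mask k) (T @ (i + b, j) # T')" if "completes (Suc i) j (occupy x b) T'" for T'
    using assms(1,4,5) admissible that by (auto simp: optimal_prefix_def completes_Cons)
  moreover have "opt 0 0 (mask k) = enat (total (T @ [(i + b, j)])) + opt (Suc i) j (occupy x b)"
    using assms(1,2) admissible by (simp add: optimal_prefix_def total_def ac_simps flip: plus_enat_simps)
  ultimately show ?thesis by (simp add: optimal_prefix_def)
qed

end

section \<open>Edit sets and schedules\<close>

lemma is_ordering_imp_list:
  assumes "is_ordering A f"
  obtains xs where "distinct xs" "set xs = A" "\<forall>r<length xs. f (xs ! r) = Suc r"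
proof
  let ?xs = "map (inv_into A f) [1..<Suc (card A)]"
  have bij: "bij_betw f A {1..card A}" using assms by (simp add: is_ordering_def)
  then have bij_inv: "bij_betw (inv_into A f) {1..card A} A" by (rule bij_betw_inv_into)
  have range: "set [1..<Suc (card A)] = {1..card A}" by auto
  show "distinct ?xs" using bij_betw_imp_inj_on[OF bij_inv] unfolding distinct_map range by simp
  show "set ?xs = A" unfolding set_map range using bij_betw_imp_surj_on[OF bij_inv] .
  show "\<forall>r<length ?xs. f (?xs ! r) = Suc r"
    using bij_betw_inv_into_right[OF bij] by (simp del: upt_Suc)
qed

lemma list_imp_is_ordering:
  assumes "distinct xs"
  obtains f where "is_ordering (set xs) f" "\<forall>r<length xs. f (xs ! r) = Suc r"
proof
  let ?pos = "inv_into {..<length xs} ((!) xs)"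
  have nth: "bij_betw ((!) xs) {..<length xs} (set xs)" using assms by (simp add: bij_betw_nth)
  have "bij_betw Suc {..<length xs} {1..card (set xs)}"
    using distinct_card[OF assms] by (simp add: bij_betw_def image_Suc_lessThan)
  from bij_betw_trans[OF bij_betw_inv_into[OF nth] this]
  show "is_ordering (set xs) (\<lambda>s. Suc (?pos s))" by (simp add: is_ordering_def comp_def)
  show "\<forall>r<length xs. Suc (?pos (xs ! r)) = Suc r"
    using bij_betw_inv_into_left[OF nth] by simp
qed

locale near_chain =
  fixes m p k :: nat and E :: "(nat \<times> nat) set" and \<alpha> \<beta> :: "nat \<Rightarrow> nat"
  assumes near_chain_instance: "near_chain_instance {..<m} {..<p} E \<alpha> \<beta> k"
begin

lemma k_pos: "0 < k" and E_subset: "E \<subseteq> {..<m} \<times> {..<p}"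
  and bij_\<alpha>: "bij_betw \<alpha> {..<m} {1..m}" and bij_\<beta>: "bij_betw \<beta> {..<p} {1..p}"
  using near_chain_instance by (auto simp: near_chain_instance_def is_ordering_def)

lemma \<alpha>_bounds: "s < m \<Longrightarrow> 1 \<le> \<alpha> s \<and> \<alpha> s \<le> m"
  using bij_betw_apply[OF bij_\<alpha>, of s] by simp

definition slot :: "nat \<Rightarrow> nat" where
  "slot s = \<alpha> s + k - 1"

lemma bij_slot: "bij_betw slot {..<m} {k..<m + k}"
proof -
  have "bij_betw (\<lambda>a. a + k - 1) {1..m} {k..<m + k}"
    by (rule bij_betw_byWitness[where f' = "\<lambda>t. t + 1 - k"]) (use k_pos in auto)
  from bij_betw_trans[OF bij_\<alpha> this] show ?thesis
    by (simp add: slot_def comp_def cong: bij_betw_cong)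
qed

text \<open>The value 0 for the remaining slots is what zero-initialised memory holds.\<close>

definition student :: "nat \<Rightarrow> nat" where
  "student t = (if t \<in> slot ` {..<m} then inv_into {..<m} slot t else 0)"

lemma student_slot: "s < m \<Longrightarrow> student (slot s) = s"
  using bij_betw_inv_into_left[OF bij_slot] by (simp add: student_def)

lemma slot_student:
  assumes "t \<in> {k..<m + k}"
  shows "slot (student t) = t" "student t < m"
  using assms bij_betw_imp_surj_on[OF bij_slot] f_inv_into_f[of t slot "{..<m}"]
    inv_into_into[of t slot "{..<m}"] by (auto simp: student_def)

definition differs :: "nat \<Rightarrow> nat \<Rightarrow> nat \<Rightarrow> bool" where
  "differs s l q \<longleftrightarrow> (\<beta> q \<le> l) \<noteq> ((s, q) \<in> E)"

definition diffs :: "nat \<Rightarrow> nat \<Rightarrow> nat list" where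
  "diffs s l = filter (differs s l) [0..<p]"

definition edits :: "(nat \<times> nat) list \<Rightarrow> (nat \<times> nat) list" where
  "edits T = concat (map (\<lambda>(t, l). map (Pair (student t)) (diffs (student t) l)) T)"

lemma edits_append: "edits (T @ T') = edits T @ edits T'"
  by (simp add: edits_def)

sublocale schedule m p k "\<lambda>t l. length (diffs (student t) l)" .

lemma total_eq_length_edits: "total T = length (edits T)"
  by (induction T) (auto simp: total_def edits_def)

definition level_edits :: "(nat \<Rightarrow> nat) \<Rightarrow> (nat \<times> nat) set" where
  "level_edits lev = {(s, q). s < m \<and> q < p \<and> differs s (lev s) q}"

lemma edited_level_edits: "edited E (level_edits lev) = {(s, q). s < m \<and> q < p \<and> \<beta> q \<le> lev s}"
  using E_subset by (auto simp: edited_def level_edits_def differs_def)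

definition easiest :: "nat \<Rightarrow> nat set" where
  "easiest l = {q. q < p \<and> \<beta> q \<le> l}"

lemma inv_into_\<beta>_image: "l \<le> p \<Longrightarrow> inv_into {..<p} \<beta> ` {1..l} = easiest l"
proof -
  assume "l \<le> p"
  then have "{1..l} = \<beta> ` easiest l"
    using bij_betw_imp_surj_on[OF bij_\<beta>] by (fastforce simp: easiest_def set_eq_iff image_iff)
  then show ?thesis
    using bij_betw_imp_inj_on[OF bij_\<beta>] by (simp add: easiest_def inv_into_image_cancel subset_iff)
qed

lemma easiest_subset_iff:
  assumes "l \<le> p" "l' \<le> p"
  shows "easiest l \<subseteq> easiest l' \<longleftrightarrow> l \<le> l'"
proof
  assume subset: "easiest l \<subseteq> easiest l'"
  show "l \<le> l'"
  proof (cases "l = 0")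
    case False
    then have "l \<in> \<beta> ` {..<p}" using assms bij_betw_imp_surj_on[OF bij_\<beta>] by auto
    then show ?thesis using subset by (auto simp: easiest_def)
  qed simp
qed (auto simp: easiest_def)

definition arranged :: "nat list \<Rightarrow> (nat \<Rightarrow> nat) \<Rightarrow> bool" where
  "arranged ss lev \<longleftrightarrow> distinct ss \<and> set ss = {..<m} \<and> in_windows 0 (map slot ss) \<and>
     sorted (map lev ss) \<and> (\<forall>s<m. lev s \<le> p)"

lemma near_iff_in_windows:
  assumes students: "set ss = {..<m}" and positions: "\<forall>r<length ss. \<pi> (ss ! r) = Suc r"
  shows "near {..<m} k \<alpha> \<pi> \<longleftrightarrow> in_windows 0 (map slot ss)"
proof -
  have "int (\<pi> s) \<in> {int (\<alpha> s) - int k..int (\<alpha> s) + int k} \<longleftrightarrow> slot s \<in> {r..r + 2 * k}"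
    if "r < length ss" "s = ss ! r" for r s
    using that positions \<alpha>_bounds[of s] k_pos nth_mem[of r ss] students by (auto simp: slot_def)
  then show ?thesis
    by (simp add: near_def in_windows_def all_set_conv_all_nth flip: students)
qed

lemma feasible_imp_arranged:
  assumes "feasible_edits {..<m} {..<p} E \<alpha> \<beta> k F"
  obtains ss lev where "arranged ss lev" "F = level_edits lev"
proof -
  let ?E = "edited E F"
  from assms obtain \<pi> where ordering: "is_ordering {..<m} \<pi>" "nested {..<m} ?E \<pi>" "near {..<m} k \<alpha> \<pi>"
    by (auto simp: feasible_edits_def)
  from ordering(1) obtain ss where students: "distinct ss" "set ss = {..<m}"
    "\<forall>r<length ss. \<pi> (ss ! r) = Suc r"
    by (rule is_ordering_imp_list)
  have "\<exists>l\<le>p. nbhd ?E s = easiest l" if "s < m" for s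
  proof -
    have "interval_property {..<m} {..<p} ?E \<beta>" using assms by (simp add: feasible_edits_def)
    with that have "\<exists>l\<in>{0..p}. nbhd ?E s = inv_into {..<p} \<beta> ` {1..l}"
      by (simp add: interval_property_def)
    then show ?thesis using inv_into_\<beta>_image by auto
  qed
  then obtain lev where levels: "\<And>s. s < m \<Longrightarrow> lev s \<le> p" "\<And>s. s < m \<Longrightarrow> nbhd ?E s = easiest (lev s)"
    by metis
  show thesis
  proof (rule that)
    have "lev s' \<le> lev s" if "s < m" "s' < m" "\<pi> s' \<le> \<pi> s" for s s'
      using ordering(2) that levels easiest_subset_iff[of "lev s'" "lev s"] by (auto simp: nested_def)
    then have "lev (ss ! r) \<le> lev (ss ! r')" if "r \<le> r'" "r' < length ss" for r r'
      using that students(3) nth_mem[of r ss] nth_mem[of r' ss] unfolding students(2) by simp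
    then have "sorted (map lev ss)" by (simp add: sorted_iff_nth_mono)
    then show "arranged ss lev"
      using students ordering(3) levels(1) near_iff_in_windows[OF students(2,3)] by (simp add: arranged_def)
    have "(s, q) \<in> ?E \<longleftrightarrow> q < p \<and> \<beta> q \<le> lev s" if "s < m" for s q
      using levels(2)[OF that] by (auto simp: nbhd_def easiest_def)
    moreover have "F \<subseteq> {..<m} \<times> {..<p}" using assms by (simp add: feasible_edits_def)
    ultimately have "(s, q) \<in> F \<longleftrightarrow> (s, q) \<in> level_edits lev" for s q
      using E_subset by (auto simp: level_edits_def differs_def edited_def)
    then show "F = level_edits lev" by auto
  qed
qed

lemma arranged_imp_feasible:
  assumes "arranged ss lev"
  shows "feasible_edits {..<m} {..<p} E \<alpha> \<beta> k (level_edits lev)"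
proof -
  let ?E = "edited E (level_edits lev)"
  have students: "distinct ss" "set ss = {..<m}" and levels: "\<And>s. s < m \<Longrightarrow> lev s \<le> p"
    using assms by (simp_all add: arranged_def)
  from students(1) obtain \<pi> where ordering: "is_ordering {..<m} \<pi>" "\<forall>r<length ss. \<pi> (ss ! r) = Suc r"
    unfolding students(2)[symmetric] by (rule list_imp_is_ordering)
  have nbhd: "nbhd ?E s = easiest (lev s)" if "s < m" for s
    using that by (auto simp: edited_level_edits nbhd_def easiest_def)
  have "near {..<m} k \<alpha> \<pi>"
    using assms near_iff_in_windows[OF students(2) ordering(2)] by (simp add: arranged_def)
  moreover have "nested {..<m} ?E \<pi>"
    unfolding nested_def
  proof (intro ballI impI)
    fix s s' assume "s \<in> {..<m}" "s' \<in> {..<m}" "\<pi> s' \<le> \<pi> s"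
    then obtain r r' where "s = ss ! r" "s' = ss ! r'" "r' \<le> r" "r < length ss"
      using ordering(2) unfolding students(2)[symmetric] in_set_conv_nth by auto
    then have "lev s' \<le> lev s"
      using assms by (simp add: arranged_def sorted_iff_nth_mono)
    with \<open>s \<in> _\<close> \<open>s' \<in> _\<close> show "nbhd ?E s' \<subseteq> nbhd ?E s" using levels by (simp add: nbhd easiest_subset_iff)
  qed
  moreover have "interval_property {..<m} {..<p} ?E \<beta>"
    unfolding interval_property_def using nbhd inv_into_\<beta>_image levels
    by (metis atLeastAtMost_iff card_lessThan lessThan_iff zero_le)
  moreover have "level_edits lev \<subseteq> {..<m} \<times> {..<p}" by (auto simp: level_edits_def)
  ultimately show ?thesis using ordering(1) by (auto simp: feasible_edits_def)
qed

definition schedule_of :: "nat list \<Rightarrow> (nat \<Rightarrow> nat) \<Rightarrow> (nat \<times> nat) list" where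
  "schedule_of ss lev = map (\<lambda>s. (slot s, lev s)) ss"

lemma completes_start_iff:
  "completes 0 0 (mask k) T \<longleftrightarrow> distinct (map fst T) \<and> fst ` set T = {k..<m + k} \<and>
     in_windows 0 (map fst T) \<and> sorted (map snd T) \<and> (\<forall>l\<in>snd ` set T. l \<le> p)"
proof -
  have "taken 0 (mask k) = {0..<k}" using taken_eq_iff[of 0 "mask k" k] by simp
  moreover have "length T = m" if "distinct (map fst T)" "fst ` set T = {k..<m + k}"
    using distinct_card[OF that(1)] that(2) by simp
  moreover have "{0..<m + k} - {0..<k} = {k..<m + k}" by auto
  ultimately show ?thesis by (auto simp: completes_def fills_iff)
qed

lemma arranged_imp_completes: "arranged ss lev \<Longrightarrow> completes 0 0 (mask k) (schedule_of ss lev)"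
  using bij_slot
  by (auto simp: completes_start_iff arranged_def schedule_of_def comp_def distinct_map
      image_image bij_betw_def)

lemma completes_imp_arranged:
  assumes "completes 0 0 (mask k) T"
  obtains ss lev where "arranged ss lev" "T = schedule_of ss lev"
proof -
  define ss where "ss = map (student \<circ> fst) T"
  define lev where "lev s = the (map_of T (slot s))" for s
  have distinct: "distinct (map fst T)" and slots: "fst ` set T = {k..<m + k}"
    and windows: "in_windows 0 (map fst T)" and sorted: "sorted (map snd T)"
    and levels: "\<forall>l\<in>snd ` set T. l \<le> p"
    using assms by (simp_all add: completes_start_iff)
  have owner: "slot (student (fst a)) = fst a" if "a \<in> set T" for a
    using that slots by (intro slot_student) blast
  then have map_slot: "map slot ss = map fst T" by (simp add: ss_def)
  have "map_of T (fst a) = Some (snd a)" if "a \<in> set T" for a using that distinct by simp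
  with owner have map_lev: "map lev ss = map snd T" by (simp add: ss_def lev_def)
  have "schedule_of ss lev = zip (map slot ss) (map lev ss)"
    by (simp add: schedule_of_def zip_map_map zip_same_conv_map)
  then have schedule: "T = schedule_of ss lev" by (simp add: map_slot map_lev zip_map_fst_snd)
  have "set ss = student ` slot ` {..<m}"
    unfolding bij_betw_imp_surj_on[OF bij_slot] slots[symmetric] by (simp add: ss_def image_image)
  also have "\<dots> = {..<m}" by (simp add: image_image student_slot)
  finally have set_ss: "set ss = {..<m}" .
  have "distinct ss" using distinct unfolding map_slot[symmetric] by (simp add: distinct_map)
  moreover have "\<forall>s<m. lev s \<le> p"
    using levels set_ss unfolding schedule by (auto simp: schedule_of_def)
  ultimately have "arranged ss lev"
    using windows sorted set_ss unfolding map_slot[symmetric] map_lev[symmetric]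
    by (simp add: arranged_def)
  with schedule show thesis by (rule that[rotated])
qed

lemma set_edits_schedule_of:
  assumes "arranged ss lev"
  shows "set (edits (schedule_of ss lev)) = level_edits lev"
  using assms
  by (auto simp: edits_def schedule_of_def arranged_def level_edits_def diffs_def student_slot)

lemma total_schedule_of:
  assumes "arranged ss lev"
  shows "total (schedule_of ss lev) = card (level_edits lev)"
proof -
  have students: "distinct ss" "set ss = {..<m}" using assms by (simp_all add: arranged_def)
  have "total (schedule_of ss lev) = (\<Sum>s\<in>{..<m}. length (diffs (student (slot s)) (lev s)))"
    using sum_list_distinct_conv_sum_set[OF students(1)] students(2)
    by (simp add: total_def schedule_of_def comp_def)
  also have "\<dots> = (\<Sum>s\<in>{..<m}. card (set (diffs s (lev s))))"
    by (intro sum.cong refl) (simp add: student_slot diffs_def flip: distinct_card)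
  also have "\<dots> = card (SIGMA s:{..<m}. set (diffs s (lev s)))"
    by (rule card_SigmaI[symmetric]) auto
  also have "(SIGMA s:{..<m}. set (diffs s (lev s))) = level_edits lev"
    by (auto simp: level_edits_def diffs_def)
  finally show ?thesis .
qed

lemma opt_start_finite: "opt 0 0 (mask k) \<noteq> \<infinity>"
proof -
  have "is_ordering {..<m} \<alpha>" using bij_\<alpha> by (simp add: is_ordering_def)
  then obtain ss where students: "distinct ss" "set ss = {..<m}" "\<forall>r<length ss. \<alpha> (ss ! r) = Suc r"
    by (rule is_ordering_imp_list)
  have "near {..<m} k \<alpha> \<alpha>" by (simp add: near_def)
  then have "arranged ss (\<lambda>_. 0)"
    using students near_iff_in_windows[OF students(2,3)] by (simp add: arranged_def map_replicate_const)
  from opt_le_total[OF arranged_imp_completes[OF this]] show ?thesis by (auto simp: enat_ile)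
qed

lemma optimal_schedule_imp_solution:
  assumes optimal: "completes 0 0 (mask k) T" "opt 0 0 (mask k) = enat (total T)"
  shows "near_chain_solution {..<m} {..<p} E \<alpha> \<beta> k (set (edits T))" "distinct (edits T)"
proof -
  obtain ss lev where arranged: "arranged ss lev" "T = schedule_of ss lev"
    using optimal(1) by (rule completes_imp_arranged)
  have card: "card (set (edits T)) = total T"
    using arranged set_edits_schedule_of total_schedule_of by simp
  then show "distinct (edits T)" by (simp add: card_distinct total_eq_length_edits)
  have "card (set (edits T)) \<le> card F" if feasible: "feasible_edits {..<m} {..<p} E \<alpha> \<beta> k F" for F
  proof -
    from feasible obtain ss' lev' where arranged': "arranged ss' lev'" "F = level_edits lev'"
      by (rule feasible_imp_arranged)
    from opt_le_total[OF arranged_imp_completes[OF arranged'(1)]] show ?thesis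
      by (simp add: optimal(2) card total_schedule_of[OF arranged'(1)] arranged'(2))
  qed
  moreover have "feasible_edits {..<m} {..<p} E \<alpha> \<beta> k (set (edits T))"
    using arranged_imp_feasible[OF arranged(1)] by (simp add: arranged set_edits_schedule_of)
  ultimately show "near_chain_solution {..<m} {..<p} E \<alpha> \<beta> k (set (edits T))"
    by (auto simp: near_chain_solution_def is_arg_min_linorder)
qed

end

section \<open>The layout of the memory\<close>

text \<open>\<open>R_width\<close> holds the number of masks, \<open>R_layer\<close> the number of nodes of a position and \<open>R_sink\<close> the
  final node. While slot \<open>i + b\<close> is tried for the node \<open>(i, j, x)\<close>, \<open>R_rest\<close> and \<open>R_power\<close> hold
  \<open>x div 2\<^sup>b\<close> and \<open>2\<^sup>b\<close>. \<open>R_row\<close> is the offset of a student's row in \<open>A_edge\<close>. The arrays \<open>A_student\<close> and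
  \<open>A_row\<close> are indexed by slots; \<open>A_value\<close>, \<open>A_choice\<close> and \<open>A_next\<close> by nodes.\<close>

abbreviation (input) "R_addr \<equiv> 0 :: nat"
abbreviation (input) "R_m \<equiv> 2 :: nat"
abbreviation (input) "R_p \<equiv> 3 :: nat"
abbreviation (input) "R_k \<equiv> 4 :: nat"
abbreviation (input) "R_width \<equiv> 5 :: nat"
abbreviation (input) "R_layer \<equiv> 6 :: nat"
abbreviation (input) "R_mask \<equiv> 7 :: nat"
abbreviation (input) "R_slots \<equiv> 8 :: nat"
abbreviation (input) "R_sink \<equiv> 9 :: nat"
abbreviation (input) "R_i \<equiv> 10 :: nat"
abbreviation (input) "R_j \<equiv> 11 :: nat"
abbreviation (input) "R_x \<equiv> 12 :: nat"
abbreviation (input) "R_node \<equiv> 13 :: nat"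
abbreviation (input) "R_value \<equiv> 14 :: nat"
abbreviation (input) "R_choice \<equiv> 15 :: nat"
abbreviation (input) "R_next \<equiv> 16 :: nat"
abbreviation (input) "R_rest \<equiv> 17 :: nat"
abbreviation (input) "R_power \<equiv> 18 :: nat"
abbreviation (input) "R_b \<equiv> 19 :: nat"
abbreviation (input) "R_quot \<equiv> 20 :: nat"
abbreviation (input) "R_rem \<equiv> 21 :: nat"
abbreviation (input) "R_sum \<equiv> 22 :: nat"
abbreviation (input) "R_index \<equiv> 23 :: nat"
abbreviation (input) "R_cand \<equiv> 24 :: nat"
abbreviation (input) "R_row \<equiv> 25 :: nat"
abbreviation (input) "R_q \<equiv> 26 :: nat"
abbreviation (input) "R_edge \<equiv> 27 :: nat"
abbreviation (input) "R_goal \<equiv> 28 :: nat"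
abbreviation (input) "R_student \<equiv> 29 :: nat"

abbreviation (input) "A_student \<equiv> 0 :: nat"
abbreviation (input) "A_row \<equiv> 7 :: nat"
abbreviation (input) "A_rank \<equiv> 2 :: nat"
abbreviation (input) "A_edge \<equiv> 3 :: nat"
abbreviation (input) "A_value \<equiv> 4 :: nat"
abbreviation (input) "A_choice \<equiv> 5 :: nat"
abbreviation (input) "A_next \<equiv> 6 :: nat"

text \<open>Infinity is stored as 0, which is what memory initially holds.\<close>

definition stored :: "enat \<Rightarrow> nat" where
  "stored v = (case v of enat n \<Rightarrow> Suc n | \<infinity> \<Rightarrow> 0)"

lemma stored_infinity [simp]: "stored \<infinity> = 0"
  by (simp add: stored_def)

lemma stored_eq_0_iff [simp]: "stored v = 0 \<longleftrightarrow> v = \<infinity>"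
  by (cases v) (simp_all add: stored_def)

lemma stored_zero: "stored 0 = 1"
  by (simp add: stored_def zero_enat_def)

lemma stored_add: "v \<noteq> \<infinity> \<Longrightarrow> stored (v + enat n) = stored v + n"
  by (auto simp: stored_def)

lemma stored_better_iff: "w \<noteq> \<infinity> \<Longrightarrow> stored v = 0 \<or> stored w < stored v \<longleftrightarrow> w < v"
  by (cases v) (auto simp: stored_def)

lemma radix_less_iff:
  fixes a a' c c' B :: nat
  assumes "c < B" "c' < B"
  shows "a * B + c < a' * B + c' \<longleftrightarrow> a < a' \<or> a = a' \<and> c < c'"
proof (cases a a' rule: linorder_cases)
  case less
  then have "Suc a * B \<le> a' * B" by (intro mult_le_mono1) simp
  with less assms show ?thesis by simp
next
  case greater
  then have "Suc a' * B \<le> a * B" by (intro mult_le_mono1) simp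
  with greater assms show ?thesis by simp
qed simp

context near_chain
begin

definition width :: nat where
  "width = 2 ^ (2 * k)"

text \<open>There is an extra level \<open>p + 1\<close>, on which only the node \<open>(m, p + 1, mask k)\<close> has a finite
  value. Hence neither the last level nor the last position requires a special case.\<close>

definition idx :: "nat \<Rightarrow> nat \<Rightarrow> nat \<Rightarrow> nat" where
  "idx i j x = (i * (p + 2) + j) * width + x"

lemma idx_less_iff:
  assumes "j < p + 2" "j' < p + 2" "x < width" "x' < width"
  shows "idx i j x < idx i' j' x' \<longleftrightarrow> i < i' \<or> i = i' \<and> (j < j' \<or> j = j' \<and> x < x')"
proof -
  have "i * (p + 2) + j = i' * (p + 2) + j' \<longleftrightarrow> i = i' \<and> j = j'"
    using radix_less_iff[OF assms(1,2), of i i'] radix_less_iff[OF assms(2,1), of i' i]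
    by (metis nat_neq_iff)
  then show ?thesis
    unfolding idx_def radix_less_iff[OF assms(3,4)] radix_less_iff[OF assms(1,2)] by blast
qed

lemma idx_eq_iff:
  assumes "j < p + 2" "j' < p + 2" "x < width" "x' < width"
  shows "idx i j x = idx i' j' x' \<longleftrightarrow> i = i' \<and> j = j' \<and> x = x'"
  using idx_less_iff[OF assms, of i i'] idx_less_iff[OF assms(2,1,4,3), of i' i] by auto

lemma idx_Suc:
  "idx (Suc i) j x = idx i j x + (p + 2) * width"
  "idx i (Suc j) x = idx i j x + width"
  "idx i j (Suc x) = Suc (idx i j x)"
  by (simp_all add: idx_def algebra_simps)

lemma mask_less_width: "mask k < width"
proof -
  have "mask k < (2 :: nat) ^ k" by simp
  also have "\<dots> \<le> width" unfolding width_def by (intro power_increasing) auto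
  finally show ?thesis .
qed

definition prepared :: "memory \<Rightarrow> bool" where
  "prepared M \<longleftrightarrow> M R_m = m \<and> M R_p = p \<and> M R_k = k \<and> M R_width = width \<and>
     M R_layer = (p + 2) * width \<and> M R_mask = mask k \<and> M R_slots = 2 * k + 1 \<and>
     M R_sink = idx m (Suc p) (mask k) \<and>
     arr A_student M = student \<and> arr A_row M = (\<lambda>t. student t * p) \<and> (\<forall>q<p. arr A_rank M q = \<beta> q) \<and>
     (\<forall>s. \<forall>q<p. arr A_edge M (s * p + q) = of_bool ((s, q) \<in> E))"

lemma prepared_frame:
  assumes "prepared M" "frame X M M'" "X \<subseteq> insert R_addr {10..<32}"
  shows "prepared M'"
proof -
  have "M' r = M r" if "r \<in> {2..9}" for r
    using assms(3) that by (intro frame_get[OF assms(2)]) auto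
  moreover have "arr a M' = arr a M" for a
    using assms(3) by (intro frame_arr[OF assms(2)]) auto
  ultimately show ?thesis using assms(1) by (simp add: prepared_def)
qed

lemma prepared_reg [simp]: "r \<in> insert R_addr {10..<32} \<Longrightarrow> prepared (M(r := v)) \<longleftrightarrow> prepared M"
  by (rule iffI; erule prepared_frame[where X = "{r}"]) (simp_all add: frame_def)

fun next_mask :: "nat \<Rightarrow> nat \<Rightarrow> nat" where
  "next_mask x 0 = x"
| "next_mask x (Suc b) = occupy x b"

definition value_stored :: "nat \<Rightarrow> nat \<Rightarrow> nat \<Rightarrow> memory \<Rightarrow> bool" where
  "value_stored i j x M \<longleftrightarrow> arr A_value M (idx i j x) = stored (opt i j x)"

definition move_stored :: "nat \<Rightarrow> nat \<Rightarrow> nat \<Rightarrow> memory \<Rightarrow> bool" where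
  "move_stored i j x M \<longleftrightarrow>
     is_arg_min (move_value i j x) (\<lambda>c. c \<le> 2 * k + 1) (arr A_choice M (idx i j x)) \<and>
     arr A_next M (idx i j x) = next_mask x (arr A_choice M (idx i j x))"

definition solved :: "nat \<Rightarrow> memory \<Rightarrow> bool" where
  "solved N M \<longleftrightarrow> (\<forall>i\<le>Suc m. \<forall>j\<le>Suc p. \<forall>x<width.
     (m < i \<or> p < j \<or> N \<le> idx i j x \<longrightarrow> value_stored i j x M) \<and>
     (i \<le> m \<and> j \<le> p \<and> N \<le> idx i j x \<longrightarrow> move_stored i j x M))"

lemma solved_cong:
  assumes "solved N M" "\<And>a. arr a M' = arr a M"
  shows "solved N M'"
  using assms by (simp add: solved_def value_stored_def move_stored_def)

lemma solved_frame: "solved N M \<Longrightarrow> frame X M M' \<Longrightarrow> X \<subseteq> {..<32} \<Longrightarrow> solved N M'"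
  by (erule solved_cong) (rule frame_arr)

lemma solved_reg [simp]: "r < 32 \<Longrightarrow> solved N (M(r := v)) \<longleftrightarrow> solved N M"
  by (rule iffI; erule solved_cong) simp_all

end

section \<open>Solving a node\<close>

definition halve :: "nat \<Rightarrow> program" where
  "halve s = block
     [Move (To_Cell R_quot) (Const 0),
      Move (To_Cell R_rem) (Cell s),
      While (Leq (Const 2) (Cell R_rem)) (block
        [Sub (To_Cell R_rem) (Cell R_rem) (Const 2),
         Add (To_Cell R_quot) (Cell R_quot) (Const 1)])]"

definition visit :: "program \<Rightarrow> program" where
  "visit P = block
     [Add (To_Cell R_index) (Cell R_row) (Cell R_q),
      load R_edge A_edge R_index,
      load R_goal A_rank R_q,
      If (Leq (Cell R_goal) (Cell R_j)) (Move (To_Cell R_goal) (Const 1)) (Move (To_Cell R_goal) (Const 0)),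
      If (Equal (Cell R_goal) (Cell R_edge)) Skip P]"

definition scan :: "program \<Rightarrow> program" where
  "scan P = for_up R_q R_p (visit P)"

definition accept :: program where
  "accept = block
     [Move (To_Cell R_value) (Cell R_cand),
      Add (To_Cell R_choice) (Cell R_b) (Const 1),
      Move (To_Cell R_next) (Cell R_quot)]"

definition keep_better :: program where
  "keep_better =
     If (Less (Const 0) (Cell R_value))
       (If (Less (Cell R_cand) (Cell R_value)) accept Skip)
       accept"

definition compare_cost :: program where
  "compare_cost = block
     [Add (To_Cell R_index) (Cell R_i) (Cell R_b),
      load R_row A_row R_index,
      scan (Add (To_Cell R_cand) (Cell R_cand) (Const 1)),
      keep_better]"

definition relax :: program where
  "relax = block
     [Add (To_Cell R_index) (Cell R_node) (Cell R_layer),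
      Add (To_Cell R_index) (Cell R_index) (Cell R_quot),
      Sub (To_Cell R_index) (Cell R_index) (Cell R_x),
      load R_cand A_value R_index,
      If (Less (Const 0) (Cell R_cand)) compare_cost Skip]"

definition relax_if_odd :: program where
  "relax_if_odd = If (Equal (Cell R_rem) (Const 1)) relax Skip"

definition try_free :: program where
  "try_free = block
     [Add (To_Cell R_sum) (Cell R_x) (Cell R_power),
      halve R_sum,
      relax_if_odd]"

definition try_bit :: program where
  "try_bit = block
     [halve R_rest,
      Move (To_Cell R_rest) (Cell R_quot),
      If (Equal (Cell R_rem) (Const 0)) try_free Skip]"

definition try_slot :: program where
  "try_slot = Seq try_bit (Add (To_Cell R_power) (Cell R_power) (Cell R_power))"

definition record_best :: program where
  "record_best = block
     [store A_value R_node R_value,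
      store A_choice R_node R_choice,
      store A_next R_node R_next]"

definition solve_node :: program where
  "solve_node = block
     [Add (To_Cell R_index) (Cell R_node) (Cell R_width),
      load R_value A_value R_index,
      Move (To_Cell R_choice) (Const 0),
      Move (To_Cell R_next) (Cell R_x),
      Move (To_Cell R_rest) (Cell R_x),
      Move (To_Cell R_power) (Const 1),
      for_up R_b R_slots try_slot,
      record_best]"

lemma wp_halve:
  assumes "s \<notin> {R_quot, R_rem}" "M s = n"
    and post: "\<And>u. u \<le> t + 3 * n + 3 \<Longrightarrow> Q (M(R_quot := n div 2, R_rem := n mod 2)) inp out u"
  shows "wp (halve s) Q M inp out t"
proof -
  let ?M = "\<lambda>i. M(R_quot := i, R_rem := n - 2 * i)"
  let ?body = "block
    [Sub (To_Cell R_rem) (Cell R_rem) (Const 2), Add (To_Cell R_quot) (Cell R_quot) (Const 1)]"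
  let ?I = "\<lambda>i M' inp' out'. M' = ?M i \<and> inp' = inp \<and> out' = out"
  have "wp (While (Leq (Const 2) (Cell R_rem)) ?body) Q (?M 0) inp out (t + 1 + 1)"
  proof (rule wp_While[where n = "n div 2" and c = 2 and I = ?I])
    fix i M' inp' out' t'
    assume "i < n div 2" "?I i M' inp' out'"
    moreover have "(?M i)(R_rem := n - 2 * i - 2, R_quot := Suc i) = ?M (Suc i)"
      by (auto simp: fun_eq_iff)
    ultimately show "holds M' (Leq (Const 2) (Cell R_rem)) \<and>
        wp ?body (timely (?I (Suc i)) (t' + 2)) M' inp' out' t'"
      by (auto simp: wp_simps)
  next
    fix M' inp' out' t'
    assume inv: "?I (n div 2) M' inp' out'" and time: "t' \<le> t + 1 + 1 + (2 + 1) * (n div 2) + 1"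
    have "n - 2 * (n div 2) = n mod 2" by (simp add: minus_mult_div_eq_mod)
    moreover have "Q (M(R_quot := n div 2, R_rem := n mod 2)) inp out t'"
      by (rule post) (use time div_le_dividend[of n 2] in simp)
    ultimately show "\<not> holds M' (Leq (Const 2) (Cell R_rem)) \<and> Q M' inp' out' t'"
      using inv by simp
  qed simp
  then show ?thesis
    using assms(1,2) by (simp add: halve_def wp_simps)
qed

lemma is_arg_min_atMost_Suc:
  fixes f :: "nat \<Rightarrow> 'a :: linorder"
  assumes "is_arg_min f (\<lambda>c. c \<le> n) c"
  shows "is_arg_min f (\<lambda>c. c \<le> Suc n) (if f (Suc n) < f c then Suc n else c)"
  using assms by (auto simp: is_arg_min_linorder le_Suc_eq intro: order.trans less_imp_le)

context near_chain
begin

lemma wp_visit: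
  assumes "prepared M" "M R_j = j" "M R_row = s * p" "M R_q < p"
    and agrees: "\<And>M' u. frame {R_addr, R_index, R_edge, R_goal} M M' \<Longrightarrow> u \<le> u\<^sub>0 + 15 \<Longrightarrow>
        \<not> differs s j (M R_q) \<Longrightarrow> Q M' inp out u"
    and differs: "\<And>M' u. frame {R_addr, R_index, R_edge, R_goal} M M' \<Longrightarrow> u \<le> u\<^sub>0 + 14 \<Longrightarrow>
        differs s j (M R_q) \<Longrightarrow> wp P Q M' inp out u"
  shows "wp (visit P) Q M inp out u\<^sub>0"
proof -
  have "arr A_rank M (M R_q) = \<beta> (M R_q)"
    "arr A_edge M (s * p + M R_q) = of_bool ((s, M R_q) \<in> E)"
    using assms(1,4) by (simp_all add: prepared_def)
  with assms(2,3) show ?thesis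
    by (auto simp: visit_def wp_simps intro!: agrees[unfolded differs_def] differs[unfolded differs_def])
qed

definition scan_regs :: "nat set" where
  "scan_regs = {R_addr, R_index, R_cand, R_q, R_edge, R_goal}"

lemma wp_visit_filter:
  fixes J :: "nat list \<Rightarrow> nat \<Rightarrow> nat list \<Rightarrow> bool"
  assumes "prepared M" "M R_j = j" "M R_row = s * p" "M R_q = q" "q < p"
    and inv: "J (filter (differs s j) [0..<q]) (M R_cand) out"
    and step: "\<And>M' u. frame {R_addr, R_index, R_edge, R_goal} M M' \<Longrightarrow>
      wp P (timely (\<lambda>M'' inp'' out''. frame {R_cand} M' M'' \<and> inp'' = inp \<and>
        J (filter (differs s j) [0..<q] @ [q]) (M'' R_cand) out'') (u + 2)) M' inp out u"
  shows "wp (visit P) (timely (\<lambda>M' inp' out'. frame (scan_regs - {R_q}) M M' \<and> inp' = inp \<and>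
      J (filter (differs s j) [0..<Suc q]) (M' R_cand) out') (u\<^sub>0 + 16)) M inp out u\<^sub>0"
proof (rule wp_visit[OF assms(1-3)])
  fix M' u
  assume frame: "frame {R_addr, R_index, R_edge, R_goal} M M'" and "u \<le> u\<^sub>0 + 15" "\<not> differs s j (M R_q)"
  moreover have "frame (scan_regs - {R_q}) M M'"
    using frame by (rule frame_mono) (simp add: scan_regs_def)
  ultimately show "(frame (scan_regs - {R_q}) M M' \<and> inp = inp \<and>
      J (filter (differs s j) [0..<Suc q]) (M' R_cand) out) \<and> u \<le> u\<^sub>0 + 16"
    using inv \<open>M R_q = q\<close> frame_get[OF frame] by simp
next
  fix M' u
  assume frame: "frame {R_addr, R_index, R_edge, R_goal} M M'" and time: "u \<le> u\<^sub>0 + 14"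
    and differs: "differs s j (M R_q)"
  show "wp P (timely (\<lambda>M'' inp'' out''. frame (scan_regs - {R_q}) M M'' \<and> inp'' = inp \<and>
      J (filter (differs s j) [0..<Suc q]) (M'' R_cand) out'') (u\<^sub>0 + 16)) M' inp out u"
  proof (rule wp_mono[OF step[OF frame]], elim conjE)
    fix M'' inp'' out'' u'
    assume cand: "frame {R_cand} M' M''" and "inp'' = inp" "u' \<le> u + 2"
      "J (filter (differs s j) [0..<q] @ [q]) (M'' R_cand) out''"
    moreover have "frame (scan_regs - {R_q}) M M''"
      using frame cand by (rule frame_trans) (simp add: scan_regs_def)
    ultimately show "(frame (scan_regs - {R_q}) M M'' \<and> inp'' = inp \<and>
        J (filter (differs s j) [0..<Suc q]) (M'' R_cand) out'') \<and> u' \<le> u\<^sub>0 + 16"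
      using time differs \<open>M R_q = q\<close> by simp
  qed
qed (use \<open>M R_q = q\<close> \<open>q < p\<close> in simp)

lemma wp_scan:
  fixes J :: "nat list \<Rightarrow> nat \<Rightarrow> nat list \<Rightarrow> bool"
  assumes "prepared M" "M R_j = j" "M R_row = s * p"
    and init: "J [] (M R_cand) out"
    and step: "\<And>qs M' out' u. frame scan_regs M M' \<Longrightarrow> J qs (M' R_cand) out' \<Longrightarrow>
      wp P (timely (\<lambda>M'' inp'' out''. frame {R_cand} M' M'' \<and> inp'' = inp \<and>
        J (qs @ [M' R_q]) (M'' R_cand) out'') (u + 2)) M' inp out' u"
    and post: "\<And>M' out' u. frame scan_regs M M' \<Longrightarrow> J (diffs s j) (M' R_cand) out' \<Longrightarrow>
      u \<le> u\<^sub>0 + 18 * p + 2 \<Longrightarrow> Q M' inp out' u"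
  shows "wp (scan P) Q M inp out u\<^sub>0"
proof -
  let ?I = "\<lambda>n M' inp' out'. frame scan_regs M M' \<and> inp' = inp \<and>
    J (filter (differs s j) [0..<n]) (M' R_cand) out'"
  have questions: "M R_p = p" using assms(1) by (simp add: prepared_def)
  show ?thesis
    unfolding scan_def
  proof (rule wp_for_up[where c = 16 and I = ?I])
    fix q M' inp' out' and u :: nat
    assume "q < M R_p" "M' R_q = q" and inv: "?I q M' inp' out'"
    then have frame: "frame scan_regs M M'" and "inp' = inp" by auto
    have "wp (visit P) (timely (\<lambda>M'' inp'' out''. frame (scan_regs - {R_q}) M' M'' \<and> inp'' = inp \<and>
        J (filter (differs s j) [0..<Suc q]) (M'' R_cand) out'') (u + 16)) M' inp out' u"
    proof (rule wp_visit_filter)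
      show "prepared M'" using assms(1) frame by (rule prepared_frame) (simp add: scan_regs_def)
      show "M' R_j = j" "M' R_row = s * p"
        using frame_get[OF frame] assms(2,3) by (simp_all add: scan_regs_def)
      fix M'' u' assume visited: "frame {R_addr, R_index, R_edge, R_goal} M' M''"
      have "frame scan_regs M M''" using frame visited by (rule frame_trans) (simp add: scan_regs_def)
      from step[OF this] show "wp P (timely (\<lambda>M\<^sub>3 inp'' out''. frame {R_cand} M'' M\<^sub>3 \<and> inp'' = inp \<and>
          J (filter (differs s j) [0..<q] @ [q]) (M\<^sub>3 R_cand) out'') (u' + 2)) M'' inp out' u'"
        using inv \<open>M' R_q = q\<close> frame_get[OF visited] by simp
    qed (use inv \<open>M' R_q = q\<close> \<open>q < M R_p\<close> questions in simp_all)
    then show "wp (visit P) (timely (\<lambda>M'' inp'' out''. M'' R_q = q \<and> M'' R_p = M' R_p \<and>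
        ?I (Suc q) (M''(R_q := Suc q)) inp'' out'') (u + 16)) M' inp' out' u"
      unfolding \<open>inp' = inp\<close>
      by (rule wp_mono)
        (use frame \<open>M' R_q = q\<close> in \<open>auto simp: scan_regs_def frame_def\<close>)
  qed (use init post in \<open>simp_all add: questions diffs_def scan_regs_def\<close>)
qed

definition solving :: "nat \<Rightarrow> nat \<Rightarrow> nat \<Rightarrow> memory \<Rightarrow> bool" where
  "solving i j x M \<longleftrightarrow> prepared M \<and> solved (Suc (idx i j x)) M \<and> i \<le> m \<and> j \<le> p \<and> x < width \<and>
     M R_i = i \<and> M R_j = j \<and> M R_x = x \<and> M R_node = idx i j x"

definition scratch_regs :: "nat set" where
  "scratch_regs = insert R_addr {R_value..<32}"

lemma solving_frame:
  assumes "solving i j x M" "frame X M M'" "X \<subseteq> scratch_regs"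
  shows "solving i j x M'"
proof -
  have "X \<subseteq> insert R_addr {10..<32}" "X \<subseteq> {..<32}" using assms(3) by (auto simp: scratch_regs_def)
  moreover have "M' r = M r" if "r \<in> {10..13}" for r
    using assms(3) that by (intro frame_get[OF assms(2)]) (auto simp: scratch_regs_def)
  ultimately show ?thesis
    using assms(1,2) by (auto simp: solving_def intro: prepared_frame solved_frame)
qed

lemma solving_reg [simp]:
  "r \<in> scratch_regs \<Longrightarrow> solving i j x (M(r := v)) \<longleftrightarrow> solving i j x M"
  by (rule iffI; erule solving_frame[where X = "{r}"]) (simp_all add: frame_def)

definition best_move :: "nat \<Rightarrow> nat \<Rightarrow> nat \<Rightarrow> nat \<Rightarrow> memory \<Rightarrow> bool" where
  "best_move i j x n M \<longleftrightarrow> is_arg_min (move_value i j x) (\<lambda>c. c \<le> n) (M R_choice) \<and>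
     M R_value = stored (move_value i j x (M R_choice)) \<and> M R_next = next_mask x (M R_choice)"

lemma best_move_frame:
  "best_move i j x n M \<Longrightarrow> frame X M M' \<Longrightarrow> X \<inter> {R_value, R_choice, R_next} = {} \<Longrightarrow> best_move i j x n M'"
  by (simp add: best_move_def frame_get[of X M M'])

lemma best_move_reg [simp]:
  "r \<notin> {R_value, R_choice, R_next} \<Longrightarrow> best_move i j x n (M(r := v)) \<longleftrightarrow> best_move i j x n M"
  by (simp add: best_move_def)

lemma best_move_keep:
  "best_move i j x b M \<Longrightarrow> \<not> move_value i j x (Suc b) < move_value i j x (M R_choice) \<Longrightarrow>
    best_move i j x (Suc b) M"
  using is_arg_min_atMost_Suc[of "move_value i j x" b "M R_choice"] by (simp add: best_move_def)

lemma best_move_replace: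
  assumes "best_move i j x b M" "move_value i j x (Suc b) < move_value i j x (M R_choice)"
    and "M' R_choice = Suc b" "M' R_value = stored (move_value i j x (Suc b))" "M' R_next = occupy x b"
  shows "best_move i j x (Suc b) M'"
  using assms is_arg_min_atMost_Suc[of "move_value i j x" b "M R_choice"] by (simp add: best_move_def)

lemma wp_keep_better:
  assumes best: "best_move i j x b M" and "M R_b = b" "M R_quot = occupy x b"
    and cand: "M R_cand = stored (move_value i j x (Suc b))" and finite: "move_value i j x (Suc b) \<noteq> \<infinity>"
    and post: "\<And>M' u. frame {R_value, R_choice, R_next} M M' \<Longrightarrow> best_move i j x (Suc b) M' \<Longrightarrow>
      u \<le> u\<^sub>0 + 5 \<Longrightarrow> Q M' inp out u"
  shows "wp keep_better Q M inp out u\<^sub>0"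
proof -
  have "M R_value = stored (move_value i j x (M R_choice))" using best by (simp add: best_move_def)
  then have better: "M R_value = 0 \<or> M R_cand < M R_value \<longleftrightarrow>
      move_value i j x (Suc b) < move_value i j x (M R_choice)"
    using cand stored_better_iff[OF finite] by simp
  show ?thesis
  proof (cases "move_value i j x (Suc b) < move_value i j x (M R_choice)")
    case True
    let ?M = "M(R_value := M R_cand, R_choice := Suc b, R_next := occupy x b)"
    have "best_move i j x (Suc b) ?M" using best True by (rule best_move_replace) (simp_all add: cand)
    then show ?thesis
      using better True assms(2,3) by (auto simp: keep_better_def accept_def wp_simps intro!: post)
  next
    case False
    with best have "best_move i j x (Suc b) M" by (rule best_move_keep)
    then show ?thesis
      using better False by (auto simp: keep_better_def wp_simps intro!: post)
  qed
qed

definition relax_regs :: "nat set" where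
  "relax_regs = scan_regs \<union> {R_value, R_choice, R_next, R_row}"

lemma wp_compare_cost:
  assumes state: "solving i j x M" and best: "best_move i j x b M"
    and "M R_b = b" "M R_quot = occupy x b" "admissible x b"
    and cand: "M R_cand = stored (opt (Suc i) j (occupy x b))" and finite: "opt (Suc i) j (occupy x b) \<noteq> \<infinity>"
    and post: "\<And>M' u. frame relax_regs M M' \<Longrightarrow> best_move i j x (Suc b) M' \<Longrightarrow>
      u \<le> u\<^sub>0 + 18 * p + 13 \<Longrightarrow> Q M' inp out u"
  shows "wp compare_cost Q M inp out u\<^sub>0"
proof -
  let ?s = "student (i + b)"
  let ?scan = "scan (Add (To_Cell R_cand) (Cell R_cand) (Const 1))"
  let ?M = "M(R_index := i + b, R_addr := 39 + 8 * (i + b), R_row := ?s * p)"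
  have regs: "M R_i = i" "M R_j = j" and prepared: "prepared M"
    using state by (simp_all add: solving_def)
  have located: "frame {R_addr, R_index, R_row} M ?M" by simp
  have move: "move_value i j x (Suc b) = opt (Suc i) j (occupy x b) + enat (length (diffs ?s j))"
    using \<open>admissible x b\<close> by simp
  have "wp ?scan (wp keep_better Q) ?M inp out (u\<^sub>0 + 6)"
  proof (rule wp_scan[where J = "\<lambda>qs v out'. v = M R_cand + length qs \<and> out' = out"])
    show "prepared ?M" using prepared by simp
    fix M' out' u
    assume scan: "frame scan_regs ?M M'" and time: "u \<le> u\<^sub>0 + 6 + 18 * p + 2"
      and scanned: "M' R_cand = M R_cand + length (diffs ?s j) \<and> out' = out"
    have frame: "frame (scan_regs \<union> {R_row}) M M'"
      using located scan by (rule frame_trans) (auto simp: scan_regs_def)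
    have "wp keep_better Q M' inp out u"
    proof (rule wp_keep_better)
      show "best_move i j x b M'"
        using best frame by (rule best_move_frame) (simp add: scan_regs_def)
      show "M' R_b = b" "M' R_quot = occupy x b"
        using frame_get[OF frame] assms(3,4) by (simp_all add: scan_regs_def)
      show "M' R_cand = stored (move_value i j x (Suc b))" "move_value i j x (Suc b) \<noteq> \<infinity>"
        unfolding move using scanned cand finite by (auto simp: stored_add)
    next
      fix M'' u'
      assume "frame {R_value, R_choice, R_next} M' M''" "best_move i j x (Suc b) M''" "u' \<le> u + 5"
      moreover from frame this(1) have "frame relax_regs M M''"
        by (rule frame_trans) (auto simp: relax_regs_def)
      ultimately show "Q M'' inp out u'" using time by (intro post) simp_all
    qed
    with scanned show "wp keep_better Q M' inp out' u" by simp
  qed (simp_all add: regs wp_simps)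
  then show ?thesis
    using prepared by (simp add: compare_cost_def wp_simps regs assms(3) prepared_def add.commute)
qed

lemma wp_relax:
  assumes state: "solving i j x M" and best: "best_move i j x b M"
    and slot: "M R_b = b" "M R_quot = occupy x b" "admissible x b" "b \<le> 2 * k"
    and post: "\<And>M' u. frame relax_regs M M' \<Longrightarrow> best_move i j x (Suc b) M' \<Longrightarrow>
      u \<le> u\<^sub>0 + 18 * p + 22 \<Longrightarrow> Q M' inp out u"
  shows "wp relax Q M inp out u\<^sub>0"
proof -
  let ?y = "occupy x b" and ?node = "idx i j x + (p + 2) * width + occupy x b - x"
  let ?M = "M(R_index := ?node, R_addr := 36 + 8 * ?node, R_cand := stored (opt (Suc i) j ?y))"
  have regs: "M R_x = x" "M R_node = idx i j x" "M R_layer = (p + 2) * width"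
    and bounds: "i \<le> m" "j \<le> p" "x < width" and solved: "solved (Suc (idx i j x)) M"
    using state by (simp_all add: solving_def prepared_def)
  have next_bound: "?y < width" using occupy_less bounds(3) slot(4) unfolding width_def by blast
  have node: "?node = idx (Suc i) j ?y" by (simp add: idx_def algebra_simps)
  have "idx i j x < idx (Suc i) j ?y" using bounds next_bound by (simp add: idx_less_iff)
  then have loaded: "arr A_value M ?node = stored (opt (Suc i) j ?y)"
    unfolding node using solved bounds next_bound by (simp add: solved_def value_stored_def)
  have loading: "frame {R_addr, R_index, R_cand} M ?M" by simp
  have best': "best_move i j x b ?M" using best by simp
  have "wp (If (Less (Const 0) (Cell R_cand)) compare_cost Skip) Q ?M inp out (u\<^sub>0 + 8)"
  proof (cases "opt (Suc i) j ?y = \<infinity>")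
    case True
    have "best_move i j x (Suc b) ?M" using best' by (rule best_move_keep) (simp add: True)
    moreover have "frame relax_regs M ?M" by (simp add: relax_regs_def scan_regs_def)
    ultimately have "Q ?M inp out (u\<^sub>0 + 8 + 1 + 1)" by (intro post) simp_all
    then show ?thesis using True by (simp add: wp_simps)
  next
    case False
    have "wp compare_cost Q ?M inp out (u\<^sub>0 + 8 + 1)"
    proof (rule wp_compare_cost[OF _ best'])
      show "solving i j x ?M" using state by (simp add: scratch_regs_def)
      fix M' u assume "frame relax_regs ?M M'" "best_move i j x (Suc b) M'" "u \<le> u\<^sub>0 + 8 + 1 + 18 * p + 13"
      moreover from loading this(1) have "frame relax_regs M M'"
        by (rule frame_trans) (simp add: relax_regs_def scan_regs_def)
      ultimately show "Q M' inp out u" by (intro post) simp_all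
    qed (use slot False in simp_all)
    then show ?thesis using False by (auto simp: wp_simps)
  qed
  then show ?thesis
    using loaded by (simp add: relax_def wp_simps regs slot add.commute)
qed

lemma wp_relax_if_odd:
  assumes state: "solving i j x M" and best: "best_move i j x b M"
    and slot: "M R_b = b" "M R_quot = occupy x b" "M R_rem = set_bit b x mod 2" "\<not> bit x b" "b \<le> 2 * k"
    and post: "\<And>M' u. frame relax_regs M M' \<Longrightarrow> best_move i j x (Suc b) M' \<Longrightarrow>
      u \<le> u\<^sub>0 + 18 * p + 23 \<Longrightarrow> Q M' inp out u"
  shows "wp relax_if_odd Q M inp out u\<^sub>0"
proof (cases "odd (set_bit b x)")
  case True
  then have "admissible x b" using slot(4) by (simp add: admissible_def bit_0)
  have "wp relax Q M inp out (u\<^sub>0 + 1)"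
    using state best slot(1,2) \<open>admissible x b\<close> slot(5) by (rule wp_relax) (simp add: post)
  with True slot(3) show ?thesis by (simp add: relax_if_odd_def wp_simps odd_iff_mod_2_eq_one)
next
  case False
  then have "best_move i j x (Suc b) M"
    using best by (intro best_move_keep) (simp_all add: admissible_def bit_0)
  with False slot(3) show ?thesis by (simp add: relax_if_odd_def wp_simps post)
qed

lemma wp_try_free:
  assumes state: "solving i j x M" and best: "best_move i j x b M"
    and slot: "M R_b = b" "M R_power = 2 ^ b" "\<not> bit x b" "b \<le> 2 * k"
    and post: "\<And>M' u. frame (relax_regs \<union> {R_sum, R_quot, R_rem}) M M' \<Longrightarrow> best_move i j x (Suc b) M' \<Longrightarrow>
      u \<le> u\<^sub>0 + 6 * width + 18 * p + 27 \<Longrightarrow> Q M' inp out u"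
  shows "wp try_free Q M inp out u\<^sub>0"
proof -
  have set_bit: "set_bit b x = x + 2 ^ b" using slot(3) by (simp add: set_bit_eq)
  have mask: "x < width" "M R_x = x" using state by (simp_all add: solving_def)
  have "2 ^ b \<le> width" unfolding width_def using slot(4) by (intro power_increasing) auto
  let ?M = "M(R_sum := set_bit b x, R_quot := occupy x b, R_rem := set_bit b x mod 2)"
  have halved: "frame {R_sum, R_quot, R_rem} M ?M" by simp
  have "wp (halve R_sum) (wp relax_if_odd Q) (M(R_sum := set_bit b x)) inp out (u\<^sub>0 + 1)"
  proof (rule wp_halve[where n = "set_bit b x"])
    fix u assume "u \<le> u\<^sub>0 + 1 + 3 * set_bit b x + 3"
    moreover have "3 * set_bit b x + 3 \<le> 6 * width" using mask(1) \<open>2 ^ b \<le> width\<close> by (simp add: set_bit)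
    ultimately have time: "u \<le> u\<^sub>0 + 6 * width + 4" by linarith
    have "wp relax_if_odd Q ?M inp out u"
    proof (rule wp_relax_if_odd)
      show "solving i j x ?M" "best_move i j x b ?M"
        using state best by (simp_all add: scratch_regs_def)
      fix M' u' assume "frame relax_regs ?M M'" "best_move i j x (Suc b) M'" "u' \<le> u + 18 * p + 23"
      moreover from halved this(1) have "frame (relax_regs \<union> {R_sum, R_quot, R_rem}) M M'"
        by (rule frame_trans) auto
      ultimately show "Q M' inp out u'" using time by (intro post) simp_all
    qed (use slot in simp_all)
    moreover have "set_bit b x div 2 = occupy x b" by (simp add: occupy_def drop_bit_Suc)
    ultimately show "wp relax_if_odd Q
        (M(R_sum := set_bit b x, R_quot := set_bit b x div 2, R_rem := set_bit b x mod 2)) inp out u"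
      by simp
  qed simp_all
  then show ?thesis
    using mask(2) slot(2) by (simp add: try_free_def wp_simps set_bit)
qed

lemma wp_try_bit:
  assumes state: "solving i j x M" and best: "best_move i j x b M"
    and slot: "M R_b = b" "M R_rest = drop_bit b x" "M R_power = 2 ^ b" "b \<le> 2 * k"
    and post: "\<And>M' u. frame (scratch_regs - {R_b, R_power}) M M' \<Longrightarrow> M' R_rest = drop_bit (Suc b) x \<Longrightarrow>
      best_move i j x (Suc b) M' \<Longrightarrow> u \<le> u\<^sub>0 + 9 * width + 18 * p + 32 \<Longrightarrow> Q M' inp out u"
  shows "wp try_bit Q M inp out u\<^sub>0"
proof -
  let ?M = "M(R_quot := drop_bit b x div 2, R_rem := drop_bit b x mod 2, R_rest := drop_bit (Suc b) x)"
  have halved: "frame {R_quot, R_rem, R_rest} M ?M" by simp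
  have best': "best_move i j x b ?M" using best by simp
  have half: "drop_bit b x div 2 = drop_bit (Suc b) x" by (simp add: drop_bit_Suc drop_bit_half)
  have remainder: "drop_bit b x mod 2 = of_bool (bit x b)" by (simp add: bit_iff_odd_drop_bit mod_2_eq_odd)
  have "drop_bit b x \<le> x" "x < width" using state by (simp_all add: drop_bit_eq_div solving_def)
  show ?thesis
    unfolding try_bit_def block.simps wp_Seq
  proof (rule wp_halve[where n = "drop_bit b x"])
    fix u assume "u \<le> u\<^sub>0 + 3 * drop_bit b x + 3"
    then have time: "u \<le> u\<^sub>0 + 3 * width + 3" using \<open>x < width\<close> \<open>drop_bit b x \<le> x\<close> by linarith
    have "wp (If (Equal (Cell R_rem) (Const 0)) try_free Skip) Q ?M inp out (u + 1)"
    proof (cases "bit x b")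
      case True
      then have "best_move i j x (Suc b) ?M"
        using best' by (intro best_move_keep) (simp_all add: admissible_def)
      moreover have "frame (scratch_regs - {R_b, R_power}) M ?M" by (simp add: scratch_regs_def)
      ultimately have "Q ?M inp out (u + 1 + 1 + 1)" using time by (intro post) simp_all
      then show ?thesis using True remainder by (simp add: wp_simps)
    next
      case False
      have "wp try_free Q ?M inp out (u + 1 + 1)"
      proof (rule wp_try_free[OF _ best'])
        show "solving i j x ?M" using state by (simp add: scratch_regs_def)
        fix M' u'
        assume freed: "frame (relax_regs \<union> {R_sum, R_quot, R_rem}) ?M M'"
          and "best_move i j x (Suc b) M'" "u' \<le> u + 1 + 1 + 6 * width + 18 * p + 27"
        moreover have "frame (scratch_regs - {R_b, R_power}) M M'" using halved freed
          by (rule frame_trans) (auto simp: relax_regs_def scan_regs_def scratch_regs_def)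
        moreover have "M' R_rest = drop_bit (Suc b) x"
          using frame_get[OF freed] by (simp add: relax_regs_def scan_regs_def)
        ultimately show "Q M' inp out u'" using time by (intro post) simp_all
      qed (use slot False in simp_all)
      then show ?thesis using False remainder by (simp add: wp_simps)
    qed
    then show "wp (Move (To_Cell R_rest) (Cell R_quot))
        (wp (If (Equal (Cell R_rem) (Const 0)) try_free Skip) Q)
        (M(R_quot := drop_bit b x div 2, R_rem := drop_bit b x mod 2)) inp out u"
      by (simp add: wp_atomic half)
  qed (use slot(2) in simp_all)
qed

definition slot_time :: nat where
  "slot_time = 9 * width + 18 * p + 33"

lemma wp_try_slot:
  assumes state: "solving i j x M" and best: "best_move i j x b M"
    and slot: "M R_b = b" "M R_rest = drop_bit b x" "M R_power = 2 ^ b" "b \<le> 2 * k"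
    and post: "\<And>M' u. frame scratch_regs M M' \<Longrightarrow> M' R_b = b \<Longrightarrow> M' R_rest = drop_bit (Suc b) x \<Longrightarrow>
      M' R_power = 2 ^ Suc b \<Longrightarrow> best_move i j x (Suc b) M' \<Longrightarrow> u \<le> u\<^sub>0 + slot_time \<Longrightarrow> Q M' inp out u"
  shows "wp try_slot Q M inp out u\<^sub>0"
  unfolding try_slot_def wp_Seq
proof (rule wp_try_bit[OF state best slot])
  fix M' u
  assume frame: "frame (scratch_regs - {R_b, R_power}) M M'" and "M' R_rest = drop_bit (Suc b) x"
    and best': "best_move i j x (Suc b) M'" and "u \<le> u\<^sub>0 + 9 * width + 18 * p + 32"
  moreover have "M' R_b = b" "M' R_power = 2 ^ b" using frame_get[OF frame] slot by simp_all
  moreover have "frame scratch_regs M M'" using frame by (rule frame_mono) auto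
  moreover have "best_move i j x (Suc b) (M'(R_power := 2 * 2 ^ b))" using best' by simp
  ultimately have "Q (M'(R_power := 2 * 2 ^ b)) inp out (u + 1)"
    by (intro post) (simp_all add: scratch_regs_def slot_time_def)
  then show "wp (Add (To_Cell R_power) (Cell R_power) (Cell R_power)) Q M' inp out u"
    using \<open>M' R_power = 2 ^ b\<close> by (simp add: wp_atomic mult_2)
qed

lemma wp_try_slots:
  assumes state: "solving i j x M" and best: "best_move i j x 0 M"
    and start: "M R_rest = x" "M R_power = 1"
    and post: "\<And>M' u. solving i j x M' \<Longrightarrow> best_move i j x (2 * k + 1) M' \<Longrightarrow>
      u \<le> u\<^sub>0 + (slot_time + 2) * (2 * k + 1) + 2 \<Longrightarrow> Q M' inp out u"
  shows "wp (for_up R_b R_slots try_slot) Q M inp out u\<^sub>0"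
proof -
  let ?I = "\<lambda>b M' inp' out'. solving i j x M' \<and> M' R_rest = drop_bit b x \<and> M' R_power = 2 ^ b \<and>
    best_move i j x b M' \<and> inp' = inp \<and> out' = out"
  have slots: "M R_slots = 2 * k + 1" using state by (simp add: solving_def prepared_def)
  show ?thesis
  proof (rule wp_for_up[where c = slot_time and I = ?I])
    show "?I 0 (M(R_b := 0)) inp out" using state best start by (simp add: scratch_regs_def)
    fix b M' inp' out' and u :: nat
    assume "b < M R_slots" and counter: "M' R_b = b" and inv: "?I b M' inp' out'"
    then have state': "solving i j x M'" and "b \<le> 2 * k" using slots by simp_all
    from state' show "wp try_slot (timely (\<lambda>M'' inp'' out''. M'' R_b = b \<and> M'' R_slots = M' R_slots \<and>
        ?I (Suc b) (M''(R_b := Suc b)) inp'' out'') (u + slot_time)) M' inp' out' u"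
    proof (rule wp_try_slot[where b = b])
      fix M'' u' assume tried: "frame scratch_regs M' M''" and "M'' R_b = b" "u' \<le> u + slot_time"
        "M'' R_rest = drop_bit (Suc b) x" "M'' R_power = 2 ^ Suc b" "best_move i j x (Suc b) M''"
      moreover from tried have "M'' R_slots = M' R_slots" by (rule frame_get) (simp add: scratch_regs_def)
      moreover have "solving i j x M''" using state' tried by (rule solving_frame) simp
      ultimately show "(M'' R_b = b \<and> M'' R_slots = M' R_slots \<and>
          ?I (Suc b) (M''(R_b := Suc b)) inp' out') \<and> u' \<le> u + slot_time"
        using inv by (simp add: scratch_regs_def)
    qed (use inv counter \<open>b \<le> 2 * k\<close> in simp_all)
  qed (auto simp: slots intro!: post)
qed

lemma solved_store:
  assumes state: "solving i j x M" and best: "best_move i j x (2 * k + 1) M"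
    and arrs: "arr A_value M' = (arr A_value M)(idx i j x := M R_value)"
      "arr A_choice M' = (arr A_choice M)(idx i j x := M R_choice)"
      "arr A_next M' = (arr A_next M)(idx i j x := M R_next)"
  shows "solved (idx i j x) M'"
  unfolding solved_def
proof (intro allI impI)
  fix i' j' x' :: nat assume bounds': "i' \<le> Suc m" "j' \<le> Suc p" "x' < width"
  let ?N = "idx i j x" and ?N' = "idx i' j' x'"
  have bounds: "i \<le> m" "j \<le> p" "x < width" and solved: "solved (Suc ?N) M"
    using state by (simp_all add: solving_def)
  show "(m < i' \<or> p < j' \<or> ?N \<le> ?N' \<longrightarrow> value_stored i' j' x' M') \<and>
    (i' \<le> m \<and> j' \<le> p \<and> ?N \<le> ?N' \<longrightarrow> move_stored i' j' x' M')"
  proof (cases "i' = i \<and> j' = j \<and> x' = x")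
    case True
    moreover have "opt i j x = move_value i j x (M R_choice)"
      using best bounds(2) by (intro opt_eq_move_value) (simp_all add: best_move_def)
    ultimately show ?thesis
      using best by (simp add: best_move_def value_stored_def move_stored_def arrs)
  next
    case False
    then have "?N' \<noteq> ?N" using bounds bounds' by (subst idx_eq_iff) auto
    moreover from this have "?N \<le> ?N' \<longleftrightarrow> Suc ?N \<le> ?N'" by auto
    ultimately show ?thesis
      using solved bounds' by (simp add: arrs solved_def value_stored_def move_stored_def)
  qed
qed

lemma wp_record_best:
  assumes state: "solving i j x M" and best: "best_move i j x (2 * k + 1) M"
    and post: "\<And>M'. prepared M' \<Longrightarrow> solved (idx i j x) M' \<Longrightarrow> \<forall>r\<in>{R_i..R_node}. M' r = M r \<Longrightarrow>
      Q M' inp out (u + 15)"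
  shows "wp record_best Q M inp out u"
proof -
  let ?N = "idx i j x"
  define M' where "M' = upd A_next ?N (M R_next) ((upd A_choice ?N (M R_choice)
    ((upd A_value ?N (M R_value) (M(R_addr := 36 + 8 * ?N)))(R_addr := 37 + 8 * ?N)))(R_addr := 38 + 8 * ?N))"
  have regs: "M' r = M r" if "r \<noteq> R_addr" "r < 32" for r using that by (simp add: M'_def)
  have "prepared M" "M R_node = ?N" using state by (simp_all add: solving_def)
  then have "prepared M'" unfolding prepared_def by (simp add: regs) (simp add: M'_def)
  moreover have "solved ?N M'" by (rule solved_store[OF state best]) (simp_all add: M'_def)
  ultimately have "Q M' inp out (u + 15)" using regs by (intro post) simp_all
  then show ?thesis
    using \<open>M R_node = ?N\<close> by (simp add: record_best_def wp_simps M'_def ac_simps)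
qed

definition node_time :: nat where
  "node_time = (2 * k + 1) * (slot_time + 2) + 27"

lemma wp_solve_node:
  assumes state: "solving i j x M"
    and post: "\<And>M' u. prepared M' \<Longrightarrow> solved (idx i j x) M' \<Longrightarrow>
      M' R_i = i \<Longrightarrow> M' R_j = j \<Longrightarrow> M' R_x = x \<Longrightarrow> M' R_node = idx i j x \<Longrightarrow>
      u \<le> u\<^sub>0 + node_time \<Longrightarrow> Q M' inp out u"
  shows "wp solve_node Q M inp out u\<^sub>0"
proof -
  let ?N = "idx i j x"
  let ?M = "M(R_index := ?N + width, R_addr := 36 + 8 * (?N + width), R_value := stored (move_value i j x 0),
    R_choice := 0, R_next := x, R_rest := x, R_power := 1)"
  have regs: "M R_x = x" "M R_node = ?N" "M R_width = width"
    using state by (simp_all add: solving_def prepared_def)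
  have "?N + width = idx i (Suc j) x" "?N < idx i (Suc j) x"
    using mask_less_width by (simp_all add: idx_Suc)
  then have loaded: "arr A_value M (?N + width) = stored (move_value i j x 0)"
    using state by (simp add: solving_def solved_def value_stored_def)
  have "solving i j x ?M" using state by (simp add: scratch_regs_def)
  then have "wp (for_up R_b R_slots try_slot) (wp record_best Q) ?M inp out (10 + u\<^sub>0)"
  proof (rule wp_try_slots)
    show "best_move i j x 0 ?M" by (simp add: best_move_def is_arg_min_linorder)
    fix M' u
    assume state': "solving i j x M'" and "best_move i j x (2 * k + 1) M'"
      and time: "u \<le> 10 + u\<^sub>0 + (slot_time + 2) * (2 * k + 1) + 2"
    then show "wp record_best Q M' inp out u"
    proof (elim wp_record_best)
      fix M'' assume "prepared M''" "solved ?N M''" "\<forall>r\<in>{R_i..R_node}. M'' r = M' r"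
      then show "Q M'' inp out (u + 15)"
        using state' time by (intro post) (simp_all add: solving_def node_time_def algebra_simps)
    qed
  qed simp_all
  then show ?thesis
    by (simp add: solve_node_def wp_simps regs loaded)
qed

end

section \<open>Sweeping through all nodes\<close>

definition sweep_level :: program where
  "sweep_level = block
     [Move (To_Cell R_x) (Cell R_width),
      for_down R_x (block
        [Sub (To_Cell R_node) (Cell R_node) (Const 1),
         solve_node])]"

definition sweep_position :: program where
  "sweep_position = block
     [Sub (To_Cell R_node) (Cell R_node) (Cell R_width),
      Add (To_Cell R_j) (Cell R_p) (Const 1),
      for_down R_j sweep_level]"

definition sweep :: program where
  "sweep = for_down R_i sweep_position"

context near_chain
begin

definition swept :: "nat \<Rightarrow> nat \<Rightarrow> nat \<Rightarrow> memory \<Rightarrow> bool" where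
  "swept i j x M \<longleftrightarrow> prepared M \<and> solved (idx i j x) M \<and> M R_node = idx i j x"

lemma swept_reg [simp]: "r \<in> {R_i, R_j, R_x} \<Longrightarrow> swept i j x (M(r := v)) \<longleftrightarrow> swept i j x M"
  unfolding swept_def by (intro conj_cong prepared_reg solved_reg) auto

definition level_time :: nat where
  "level_time = (node_time + 3) * width + 2"

lemma wp_sweep_level:
  assumes swept: "swept i (Suc j) 0 M" and regs: "M R_i = i" "M R_j = j" and "i \<le> m" "j \<le> p"
    and post: "\<And>M' u. swept i j 0 M' \<Longrightarrow> M' R_i = i \<Longrightarrow> M' R_j = j \<Longrightarrow> u \<le> u\<^sub>0 + level_time \<Longrightarrow>
      Q M' inp out u"
  shows "wp sweep_level Q M inp out u\<^sub>0"
proof -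
  let ?M = "M(R_x := width)"
  let ?I = "\<lambda>x M' inp' out'. swept i j x M' \<and> M' R_i = i \<and> M' R_j = j \<and> inp' = inp \<and> out' = out"
  let ?body = "block [Sub (To_Cell R_node) (Cell R_node) (Const 1), solve_node]"
  have "wp (for_down R_x ?body) Q ?M inp out (u\<^sub>0 + 1)"
  proof (rule wp_for_down[where c = "node_time + 1" and I = ?I])
    have "idx i (Suc j) 0 = idx i j width" by (simp add: idx_def)
    then show "?I (?M R_x) ?M inp out" using swept regs by (simp add: swept_def)
    fix x M' inp' out' u
    assume "x < ?M R_x" and inv: "?I (Suc x) M' inp' out'"
    let ?M' = "M'(R_x := x, R_node := idx i j x)"
    let ?post = "timely (\<lambda>M'' inp'' out''. M'' R_x = x \<and> ?I x M'' inp'' out'') (u + (node_time + 1))"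
    have "wp solve_node ?post ?M' inp out (u + 1)"
    proof (rule wp_solve_node)
      show "solving i j x ?M'"
        using inv \<open>i \<le> m\<close> \<open>j \<le> p\<close> \<open>x < ?M R_x\<close> by (simp add: solving_def swept_def idx_Suc)
    qed (simp_all add: swept_def)
    then show "wp ?body ?post (M'(R_x := x)) inp' out' u"
      using inv by (simp add: wp_simps swept_def idx_Suc)
  next
    fix M' inp' out' u
    assume "?I 0 M' inp' out'" "u \<le> u\<^sub>0 + 1 + (node_time + 1 + 2) * ?M R_x + 1"
    then show "Q M' inp' out' u" by (auto simp: level_time_def algebra_simps intro!: post)
  qed
  moreover have "M R_width = width" using swept by (simp add: swept_def prepared_def)
  ultimately show ?thesis by (simp add: sweep_level_def wp_simps)
qed

lemma solved_skip_level:
  assumes "solved (idx (Suc i) 0 0) M"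
  shows "solved (idx i (Suc p) 0) M"
proof -
  have "idx (Suc i) 0 0 \<le> idx i' j' x'"
    if "j' \<le> p" "x' < width" "idx i (Suc p) 0 \<le> idx i' j' x'" for i' j' x'
    using that by (auto simp: idx_less_iff simp flip: not_less)
  with assms show ?thesis unfolding solved_def by (meson not_le)
qed

definition position_time :: nat where
  "position_time = (level_time + 2) * (p + 1) + 3"

lemma wp_sweep_position:
  assumes swept: "swept (Suc i) 0 0 M" and "M R_i = i" "i \<le> m"
    and post: "\<And>M' u. swept i 0 0 M' \<Longrightarrow> M' R_i = i \<Longrightarrow> u \<le> u\<^sub>0 + position_time \<Longrightarrow> Q M' inp out u"
  shows "wp sweep_position Q M inp out u\<^sub>0"
proof -
  let ?M = "M(R_node := idx i (Suc p) 0, R_j := Suc p)"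
  let ?I = "\<lambda>j M' inp' out'. swept i j 0 M' \<and> M' R_i = i \<and> inp' = inp \<and> out' = out"
  have "wp (for_down R_j sweep_level) Q ?M inp out (u\<^sub>0 + 2)"
  proof (rule wp_for_down[where c = level_time and I = ?I])
    have "prepared ?M" "solved (idx i (Suc p) 0) ?M"
      using swept solved_skip_level[of i M] by (simp_all add: swept_def)
    then show "?I (?M R_j) ?M inp out" using \<open>M R_i = i\<close> by (simp add: swept_def)
    fix j M' inp' out' u
    assume "j < ?M R_j" "?I (Suc j) M' inp' out'"
    then show "wp sweep_level
        (timely (\<lambda>M'' inp'' out''. M'' R_j = j \<and> ?I j M'' inp'' out'') (u + level_time))
        (M'(R_j := j)) inp' out' u"
      using \<open>i \<le> m\<close> by (intro wp_sweep_level[where i = i and j = j]) simp_all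
  next
    fix M' inp' out' u
    assume "?I 0 M' inp' out'" "u \<le> u\<^sub>0 + 2 + (level_time + 2) * ?M R_j + 1"
    then show "Q M' inp' out' u" by (auto simp: position_time_def algebra_simps intro!: post)
  qed
  moreover have "M R_node - M R_width = idx i (Suc p) 0" "M R_p = p"
    using swept by (simp_all add: swept_def prepared_def idx_def)
  ultimately show ?thesis by (simp add: sweep_position_def wp_simps)
qed

definition sweep_time :: nat where
  "sweep_time = (position_time + 2) * (m + 1) + 1"

lemma wp_sweep:
  assumes swept: "swept (Suc m) 0 0 M" "M R_i = Suc m"
    and post: "\<And>M' u. swept 0 0 0 M' \<Longrightarrow> u \<le> u\<^sub>0 + sweep_time \<Longrightarrow> Q M' inp out u"
  shows "wp sweep Q M inp out u\<^sub>0"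
  unfolding sweep_def
proof (rule wp_for_down[where c = position_time and
      I = "\<lambda>i M' inp' out'. swept i 0 0 M' \<and> inp' = inp \<and> out' = out"])
  fix i M' inp' out' u
  assume "i < M R_i" "swept (Suc i) 0 0 M' \<and> inp' = inp \<and> out' = out"
  then show "wp sweep_position
      (timely (\<lambda>M'' inp'' out''. M'' R_i = i \<and> swept i 0 0 M'' \<and> inp'' = inp \<and> out'' = out)
        (u + position_time))
      (M'(R_i := i)) inp' out' u"
    using swept(2) by (intro wp_sweep_position[where i = i]) simp_all
qed (use swept in \<open>auto simp: sweep_time_def algebra_simps intro!: post\<close>)

end

section \<open>Tracing an optimal schedule\<close>

definition raise_level :: program where
  "raise_level = block
     [Add (To_Cell R_j) (Cell R_j) (Const 1),
      Add (To_Cell R_node) (Cell R_node) (Cell R_width)]"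

definition write_edits :: program where
  "write_edits = block
     [Add (To_Cell R_index) (Cell R_i) (Cell R_b),
      load R_student A_student R_index,
      load R_row A_row R_index,
      scan (block [Write (Cell R_student), Write (Cell R_q)])]"

definition next_position :: program where
  "next_position = block
     [load R_next A_next R_node,
      Add (To_Cell R_node) (Cell R_node) (Cell R_layer),
      Add (To_Cell R_node) (Cell R_node) (Cell R_next),
      Sub (To_Cell R_node) (Cell R_node) (Cell R_x),
      Move (To_Cell R_x) (Cell R_next),
      Add (To_Cell R_i) (Cell R_i) (Const 1)]"

definition place_student :: program where
  "place_student = block [Sub (To_Cell R_b) (Cell R_choice) (Const 1), write_edits, next_position]"

definition trace_step :: program where
  "trace_step = block
     [load R_choice A_choice R_node,
      If (Equal (Cell R_choice) (Const 0)) raise_level place_student]"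

definition trace :: program where
  "trace = block
     [Move (To_Cell R_i) (Const 0),
      Move (To_Cell R_j) (Const 0),
      Move (To_Cell R_x) (Cell R_mask),
      Move (To_Cell R_node) (Cell R_mask),
      While (Less (Cell R_node) (Cell R_sink)) trace_step]"

definition flatten :: "(nat \<times> nat) list \<Rightarrow> nat list" where
  "flatten fs = concat (map (\<lambda>(s, q). [s, q]) fs)"

lemma flatten_append: "flatten (fs @ gs) = flatten fs @ flatten gs"
  by (simp add: flatten_def)

context near_chain
begin

definition tracing :: "nat \<Rightarrow> nat \<Rightarrow> nat \<Rightarrow> memory \<Rightarrow> nat list \<Rightarrow> bool" where
  "tracing i j x M out \<longleftrightarrow> prepared M \<and> solved 0 M \<and> i \<le> m \<and> j \<le> Suc p \<and> x < width \<and>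
     M R_i = i \<and> M R_j = j \<and> M R_x = x \<and> M R_node = idx i j x \<and>
     (\<exists>T. optimal_prefix T i j x \<and> out = flatten (edits T))"

lemma optimal_prefix_finite:
  assumes "optimal_prefix T i j x"
  shows "opt i j x \<noteq> \<infinity>"
  using assms opt_start_finite unfolding optimal_prefix_def by (metis plus_eq_infty_iff_enat)

lemma tracing_raise:
  assumes "tracing i j x M out" "opt i j x = move_value i j x 0" "j \<le> p"
  shows "tracing i (Suc j) x (M(R_j := Suc j, R_node := idx i (Suc j) x)) out"
proof -
  obtain T where "optimal_prefix T i j x" "out = flatten (edits T)"
    using assms(1) by (auto simp: tracing_def)
  then have "\<exists>T. optimal_prefix T i (Suc j) x \<and> out = flatten (edits T)"
    using assms(2) optimal_prefix_raise by blast
  with assms(1,3) show ?thesis by (simp add: tracing_def)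
qed

lemma tracing_place:
  assumes tracing: "tracing i j x M out" and move: "opt i j x = move_value i j x (Suc b)"
    and "b \<le> 2 * k" "j \<le> p"
    and state': "prepared M'" "solved 0 M'" "M' R_i = Suc i" "M' R_j = j" "M' R_x = occupy x b"
      "M' R_node = idx (Suc i) j (occupy x b)"
  shows "tracing (Suc i) j (occupy x b) M' (out @ flatten (edits [(i + b, j)]))"
proof -
  obtain T where optimal: "optimal_prefix T i j x" and out: "out = flatten (edits T)"
    and bounds: "i \<le> m" "x < width"
    using tracing by (auto simp: tracing_def)
  have optimal': "optimal_prefix (T @ [(i + b, j)]) (Suc i) j (occupy x b)"
    using optimal move optimal_prefix_finite[OF optimal] assms(3,4) by (rule optimal_prefix_place)
  have "opt (Suc i) j (occupy x b) \<noteq> \<infinity>" by (rule optimal_prefix_finite[OF optimal'])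
  then have "Suc i \<le> m" using bounds(1) opt_beyond[of "Suc i" j] by (auto simp: le_less)
  moreover have "occupy x b < width" using bounds(2) assms(3) occupy_less unfolding width_def by blast
  moreover have "out @ flatten (edits [(i + b, j)]) = flatten (edits (T @ [(i + b, j)]))"
    using out by (simp add: flatten_append edits_append)
  ultimately show ?thesis using optimal' state' le_SucI[OF \<open>j \<le> p\<close>] unfolding tracing_def by blast
qed

lemma wp_write_edits:
  assumes prepared: "prepared M" and regs: "M R_i = i" "M R_j = j" "M R_b = b"
    and post: "\<And>M' u. frame (scan_regs \<union> {R_student, R_row}) M M' \<Longrightarrow> u \<le> u\<^sub>0 + 18 * p + 13 \<Longrightarrow>
      Q M' inp (out @ flatten (edits [(i + b, j)])) u"
  shows "wp write_edits Q M inp out u\<^sub>0"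
proof -
  let ?s = "student (i + b)"
  let ?M = "M(R_index := i + b, R_student := ?s, R_addr := 39 + 8 * (i + b), R_row := ?s * p)"
  have located: "frame {R_addr, R_index, R_student, R_row} M ?M" by simp
  have "wp (scan (block [Write (Cell R_student), Write (Cell R_q)])) Q ?M inp out (11 + u\<^sub>0)"
  proof (rule wp_scan[where J = "\<lambda>qs v out'. out' = out @ flatten (map (Pair ?s) qs)"])
    show "prepared ?M" using prepared by simp
    show "out = out @ flatten (map (Pair ?s) [])" by (simp add: flatten_def)
  next
    fix qs M' out' u assume scan: "frame scan_regs ?M M'" and "out' = out @ flatten (map (Pair ?s) qs)"
    moreover have "M' R_student = ?s" using frame_get[OF scan] by (simp add: scan_regs_def)
    ultimately show "wp (block [Write (Cell R_student), Write (Cell R_q)])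
        (timely (\<lambda>M'' inp'' out''. frame {R_cand} M' M'' \<and> inp'' = inp \<and>
          out'' = out @ flatten (map (Pair ?s) (qs @ [M' R_q]))) (u + 2)) M' inp out' u"
      by (simp add: wp_simps flatten_def)
  next
    fix M' out' u assume scan: "frame scan_regs ?M M'" and "u \<le> 11 + u\<^sub>0 + 18 * p + 2"
      "out' = out @ flatten (map (Pair ?s) (diffs ?s j))"
    moreover from located scan have "frame (scan_regs \<union> {R_student, R_row}) M M'"
      by (rule frame_trans) (auto simp: scan_regs_def)
    ultimately show "Q M' inp out' u" using post[of M' u] by (simp add: edits_def)
  qed (simp_all add: regs)
  moreover have "arr A_student M = student" "arr A_row M = (\<lambda>t. student t * p)"
    using prepared by (simp_all add: prepared_def)
  ultimately show ?thesis by (simp add: write_edits_def wp_simps regs)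
qed

definition trace_step_time :: nat where
  "trace_step_time = 18 * p + 30"

lemma wp_place_student:
  assumes tracing: "tracing i j x M out" and move: "opt i j x = move_value i j x (Suc b)"
    and "b \<le> 2 * k" "j \<le> p" "M R_choice = Suc b"
    and successor: "arr A_next M (idx i j x) = occupy x b"
    and post: "\<And>M' out' u. tracing (Suc i) j (occupy x b) M' out' \<Longrightarrow> u \<le> u\<^sub>0 + 18 * p + 24 \<Longrightarrow>
      Q M' inp out' u"
  shows "wp place_student Q M inp out u\<^sub>0"
proof -
  let ?N = "idx i j x" and ?y = "occupy x b" and ?out = "out @ flatten (edits [(i + b, j)])"
  have "wp write_edits (wp next_position Q) (M(R_b := b)) inp out (u\<^sub>0 + 1)"
  proof (rule wp_write_edits)
    show "prepared (M(R_b := b))" "(M(R_b := b)) R_i = i" "(M(R_b := b)) R_j = j" "(M(R_b := b)) R_b = b"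
      using tracing by (simp_all add: tracing_def)
    fix M' u assume "frame (scan_regs \<union> {R_student, R_row}) (M(R_b := b)) M'"
      and time: "u \<le> u\<^sub>0 + 1 + 18 * p + 13"
    then have frame: "frame scratch_regs M M'"
      using frame_trans[of "{R_b}" M "M(R_b := b)"] by (simp add: scan_regs_def scratch_regs_def)
    have state': "prepared M'" "solved 0 M'"
      using tracing frame by (auto simp: tracing_def scratch_regs_def intro: prepared_frame solved_frame)
    have regs: "M' R_i = i" "M' R_j = j" "M' R_x = x" "M' R_node = ?N" "M' R_layer = (p + 2) * width"
      using frame_get[OF frame] tracing by (simp_all add: tracing_def prepared_def scratch_regs_def)
    have "arr A_next M' = arr A_next M" by (rule frame_arr[OF frame]) (auto simp: scratch_regs_def)
    moreover have "?N + (p + 2) * width + ?y - x = idx (Suc i) j ?y" by (simp add: idx_def algebra_simps)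
    moreover have "tracing (Suc i) j ?y (M'(R_addr := 38 + 8 * ?N, R_next := ?y,
        R_node := idx (Suc i) j ?y, R_x := ?y, R_i := Suc i)) ?out"
      using tracing move assms(3,4) by (rule tracing_place) (use state' regs in simp_all)
    ultimately show "wp next_position Q M' inp ?out u"
      using time successor by (simp add: next_position_def wp_simps regs post)
  qed
  then show ?thesis using \<open>M R_choice = Suc b\<close> by (simp add: place_student_def wp_simps)
qed

lemma wp_trace_step:
  assumes tracing: "tracing i j x M out" and "j \<le> p"
    and raise: "\<And>M' u. tracing i (Suc j) x M' out \<Longrightarrow> u \<le> u\<^sub>0 + trace_step_time \<Longrightarrow> Q M' inp out u"
    and place: "\<And>y M' out' u. tracing (Suc i) j y M' out' \<Longrightarrow> u \<le> u\<^sub>0 + trace_step_time \<Longrightarrow> Q M' inp out' u"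
  shows "wp trace_step Q M inp out u\<^sub>0"
proof -
  let ?N = "idx i j x"
  let ?c = "arr A_choice M ?N"
  let ?M = "M(R_addr := 37 + 8 * ?N, R_choice := ?c)"
  have node: "M R_node = ?N" and width: "M R_width = width"
    using tracing by (simp_all add: tracing_def prepared_def)
  have arg_min: "is_arg_min (move_value i j x) (\<lambda>c. c \<le> 2 * k + 1) ?c"
    and successor: "arr A_next M ?N = next_mask x ?c"
    using tracing \<open>j \<le> p\<close> by (simp_all add: tracing_def solved_def move_stored_def)
  have move: "opt i j x = move_value i j x ?c" using arg_min \<open>j \<le> p\<close> by (rule opt_eq_move_value)
  have tracing': "tracing i j x ?M out" using tracing by (simp add: tracing_def)
  show ?thesis
  proof (cases ?c)
    case 0
    have "tracing i (Suc j) x (?M(R_j := Suc j, R_node := idx i (Suc j) x)) out"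
      using tracing' move[unfolded 0] \<open>j \<le> p\<close> by (rule tracing_raise)
    moreover have "M R_j = j" using tracing by (simp add: tracing_def)
    ultimately show ?thesis
      using 0
      by (simp add: trace_step_def raise_level_def wp_simps node width idx_Suc raise trace_step_time_def)
  next
    case (Suc b)
    have "wp place_student Q ?M inp out (6 + u\<^sub>0)"
    proof (rule wp_place_student[OF tracing' move[unfolded Suc]])
      show "b \<le> 2 * k" using arg_min Suc by (simp add: is_arg_min_linorder)
    qed (use \<open>j \<le> p\<close> Suc successor in \<open>auto simp: trace_step_time_def intro!: place\<close>)
    then show ?thesis using Suc by (simp add: trace_step_def wp_simps node)
  qed
qed

lemma tracing_before_sink:
  assumes "tracing i j x M out" "i + j < m + p + 1"
  shows "j \<le> p" "M R_node < M R_sink"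
proof -
  from assms(1) obtain T where "optimal_prefix T i j x" and bounds: "i \<le> m" "j \<le> Suc p" "x < width"
    by (auto simp: tracing_def)
  then have "opt i j x \<noteq> \<infinity>" by (intro optimal_prefix_finite)
  then show "j \<le> p" using opt_beyond[of i j x] bounds assms(2) by (auto simp: le_Suc_eq split: if_splits)
  then have "idx i j x < idx m (Suc p) (mask k)"
    using bounds mask_less_width by (auto simp: idx_less_iff)
  then show "M R_node < M R_sink" using assms(1) by (simp add: tracing_def prepared_def)
qed

lemma tracing_at_sink:
  assumes "tracing i j x M out" "i + j = m + p + 1"
  obtains T where "completes 0 0 (mask k) T" "opt 0 0 (mask k) = enat (total T)"
    "out = flatten (edits T)" "M R_node = M R_sink"
proof -
  from assms(1) obtain T where optimal: "optimal_prefix T i j x" and out: "out = flatten (edits T)"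
    unfolding tracing_def by blast
  have node: "M R_node = idx i j x" "M R_sink = idx m (Suc p) (mask k)" and "i = m" "j = Suc p"
    using assms by (simp_all add: tracing_def prepared_def)
  with optimal_prefix_finite[OF optimal] opt_beyond[of i j x] have "x = mask k" "opt i j x = 0"
    by (auto split: if_splits)
  moreover from this \<open>i = m\<close> have "completes i j x []" by (simp add: completes_Nil)
  ultimately show thesis
    using that[of T] optimal out node \<open>i = m\<close> \<open>j = Suc p\<close> by (auto simp: optimal_prefix_def)
qed

definition trace_time :: nat where
  "trace_time = (trace_step_time + 1) * (m + p + 1) + 5"

lemma wp_trace_loop:
  assumes start: "tracing 0 0 (mask k) M []"
    and post: "\<And>M' u T. completes 0 0 (mask k) T \<Longrightarrow> opt 0 0 (mask k) = enat (total T) \<Longrightarrow>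
      u \<le> u\<^sub>0 + (trace_step_time + 1) * (m + p + 1) + 1 \<Longrightarrow> Q M' inp (flatten (edits T)) u"
  shows "wp (While (Less (Cell R_node) (Cell R_sink)) trace_step) Q M inp [] u\<^sub>0"
proof -
  let ?I = "\<lambda>n M' inp' out'. inp' = inp \<and> (\<exists>i j x. tracing i j x M' out' \<and> i + j = n)"
  show ?thesis
  proof (rule wp_While[where n = "m + p + 1" and c = trace_step_time and I = ?I])
    show "?I 0 M inp []" using start by auto
  next
    fix n M' inp' out' u
    assume bound: "n < m + p + 1" and "?I n M' inp' out'"
    then obtain i j x where tracing: "tracing i j x M' out'" and "i + j = n" "inp' = inp" by blast
    then have "j \<le> p" and before: "M' R_node < M' R_sink"
      using tracing_before_sink[OF tracing] bound by simp_all
    from tracing \<open>j \<le> p\<close> have "wp trace_step (timely (?I (Suc n)) (u + trace_step_time)) M' inp out' u"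
      by (rule wp_trace_step) (use \<open>i + j = n\<close> in fastforce)+
    then show "holds M' (Less (Cell R_node) (Cell R_sink)) \<and>
        wp trace_step (timely (?I (Suc n)) (u + trace_step_time)) M' inp' out' u"
      using before \<open>inp' = inp\<close> by simp
  next
    fix M' inp' out' u
    assume "?I (m + p + 1) M' inp' out'" and time: "u \<le> u\<^sub>0 + (trace_step_time + 1) * (m + p + 1) + 1"
    then obtain i j x where "tracing i j x M' out'" "i + j = m + p + 1" "inp' = inp" by blast
    then obtain T where "completes 0 0 (mask k) T" "opt 0 0 (mask k) = enat (total T)"
      "out' = flatten (edits T)" "M' R_node = M' R_sink"
      by (elim tracing_at_sink)
    then show "\<not> holds M' (Less (Cell R_node) (Cell R_sink)) \<and> Q M' inp' out' u"
      using time \<open>inp' = inp\<close> by (simp add: post)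
  qed
qed

lemma wp_trace:
  assumes swept: "swept 0 0 0 M"
    and post: "\<And>M' u T. completes 0 0 (mask k) T \<Longrightarrow> opt 0 0 (mask k) = enat (total T) \<Longrightarrow>
      u \<le> u\<^sub>0 + trace_time \<Longrightarrow> Q M' inp (flatten (edits T)) u"
  shows "wp trace Q M inp [] u\<^sub>0"
proof -
  let ?M = "M(R_i := 0, R_j := 0, R_x := mask k, R_node := mask k)"
  have "\<exists>T. optimal_prefix T 0 0 (mask k) \<and> [] = flatten (edits T)"
    using optimal_prefix_Nil by (intro exI[of _ "[]"]) (simp add: flatten_def edits_def)
  then have "tracing 0 0 (mask k) ?M []"
    using swept mask_less_width by (simp add: tracing_def swept_def idx_def)
  then have "wp (While (Less (Cell R_node) (Cell R_sink)) trace_step) Q ?M inp [] (u\<^sub>0 + 1 + 1 + 1 + 1)"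
    by (rule wp_trace_loop) (simp add: post trace_time_def)
  moreover have "M R_mask = mask k" using swept by (simp add: swept_def prepared_def)
  ultimately show ?thesis by (simp add: trace_def wp_simps)
qed

end

section \<open>Reading the input\<close>

definition read_student :: program where
  "read_student = block
     [Read (To_Cell R_index),
      Add (To_Cell R_index) (Cell R_index) (Cell R_k),
      Sub (To_Cell R_index) (Cell R_index) (Const 1),
      store A_student R_index R_student,
      store A_row R_index R_row,
      Add (To_Cell R_row) (Cell R_row) (Cell R_p)]"

definition read_students :: program where
  "read_students = for_up R_student R_m read_student"

definition read_array :: "nat \<Rightarrow> nat \<Rightarrow> program" where
  "read_array a l = for_up R_q l (block [Read (To_Cell R_edge), store a R_q R_edge])"

definition read_input :: program where
  "read_input = block
     [Read (To_Cell R_m),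
      Read (To_Cell R_p),
      Read (To_Cell R_k),
      read_students,
      read_array A_rank R_p,
      read_array A_edge R_row]"

lemma wp_read_array:
  assumes "a < 8" "l < 32" "l \<notin> {R_addr, R_q, R_edge}" and limit: "M l = n"
    and post: "\<And>M' u. \<forall>r<32. r \<notin> {R_addr, R_q, R_edge} \<longrightarrow> M' r = M r \<Longrightarrow>
      \<forall>a'<8. a' \<noteq> a \<longrightarrow> arr a' M' = arr a' M \<Longrightarrow>
      arr a M' = (\<lambda>e. if e < n then f e else arr a M e) \<Longrightarrow> u \<le> u\<^sub>0 + 8 * n + 2 \<Longrightarrow> Q M' rest out u"
  shows "wp (read_array a l) Q M (map f [0..<n] @ rest) out u\<^sub>0"
proof -
  let ?I = "\<lambda>i M' inp' out'. (\<forall>r<32. r \<notin> {R_addr, R_q, R_edge} \<longrightarrow> M' r = M r) \<and>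
    (\<forall>a'<8. a' \<noteq> a \<longrightarrow> arr a' M' = arr a' M) \<and> arr a M' = (\<lambda>e. if e < i then f e else arr a M e) \<and>
    inp' = map f [i..<n] @ rest \<and> out' = out"
  show ?thesis
    unfolding read_array_def
  proof (rule wp_for_up[where c = 6 and I = ?I])
    fix i M' inp' out' and u :: nat
    assume "i < M l" "M' R_q = i" and inv: "?I i M' inp' out'"
    then have "inp' = f i # map f [Suc i..<n] @ rest" using limit by (simp add: upt_conv_Cons)
    moreover have "(\<lambda>e. if e < i then f e else arr a M e)(i := f i) =
        (\<lambda>e. if e < Suc i then f e else arr a M e)"
      by (auto simp: fun_eq_iff less_Suc_eq)
    ultimately show "wp (block [Read (To_Cell R_edge), store a R_q R_edge])
      (timely (\<lambda>M'' inp'' out''. M'' R_q = i \<and> M'' l = M' l \<and>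
        ?I (Suc i) (M''(R_q := Suc i)) inp'' out'') (u + 6)) M' inp' out' u"
      using inv \<open>M' R_q = i\<close> assms(1-3) by (simp add: wp_simps)
  qed (use assms(1-3) in \<open>auto simp: limit intro!: post\<close>)
qed

lemma concat_rows:
  "concat (map (\<lambda>s. map (f s) [0..<p]) [0..<m]) = map (\<lambda>e. f (e div p) (e mod p)) [0..<m * p]"
proof (induction m)
  case (Suc m)
  have "map (\<lambda>e. f (e div p) (e mod p)) [m * p..<m * p + p] = map (f m) [0..<p]"
    by (rule nth_equalityI) auto
  moreover have "[0..<Suc m * p] = [0..<m * p] @ [m * p..<m * p + p]"
    using upt_add_eq_append[of 0 "m * p" p] by (simp add: add.commute)
  ultimately show ?case using Suc by simp
qed simp

context near_chain
begin

definition student_below :: "nat \<Rightarrow> nat \<Rightarrow> nat" where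
  "student_below i t = (if t \<in> slot ` {..<i} then student t else 0)"

lemma student_below_Suc:
  assumes "i < m"
  shows "student_below (Suc i) = (student_below i)(slot i := i)"
  using student_slot[OF assms] by (auto simp: student_below_def fun_eq_iff less_Suc_eq)

lemma student_below_m: "student_below m = student"
  by (auto simp: student_below_def student_def fun_eq_iff)

lemma wp_read_students:
  assumes params: "M R_m = m" "M R_p = p" "M R_k = k"
    and zero: "M R_row = 0" "arr A_student M = (\<lambda>_. 0)" "arr A_row M = (\<lambda>_. 0)"
    and post: "\<And>M' u. \<forall>r<32. r \<notin> {R_addr, R_index, R_row, R_student} \<longrightarrow> M' r = M r \<Longrightarrow> M' R_row = m * p \<Longrightarrow>
      \<forall>a<8. a \<notin> {A_student, A_row} \<longrightarrow> arr a M' = arr a M \<Longrightarrow> arr A_student M' = student \<Longrightarrow>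
      arr A_row M' = (\<lambda>t. student t * p) \<Longrightarrow> u \<le> u\<^sub>0 + 16 * m + 2 \<Longrightarrow> Q M' rest out u"
  shows "wp read_students Q M (map \<alpha> [0..<m] @ rest) out u\<^sub>0"
proof -
  let ?I = "\<lambda>i M' inp' out'. (\<forall>r<32. r \<notin> {R_addr, R_index, R_row, R_student} \<longrightarrow> M' r = M r) \<and>
    M' R_row = i * p \<and> (\<forall>a<8. a \<notin> {A_student, A_row} \<longrightarrow> arr a M' = arr a M) \<and>
    arr A_student M' = student_below i \<and> arr A_row M' = (\<lambda>t. student_below i t * p) \<and>
    inp' = map \<alpha> [i..<m] @ rest \<and> out' = out"
  show ?thesis
    unfolding read_students_def
  proof (rule wp_for_up[where c = 14 and I = ?I])
    fix i M' inp' out' and u :: nat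
    assume "i < M R_m" and counter: "M' R_student = i" and inv: "?I i M' inp' out'"
    then have "i < m" using params(1) by simp
    then have "inp' = \<alpha> i # map \<alpha> [Suc i..<m] @ rest" using inv by (simp add: upt_conv_Cons)
    moreover have "\<alpha> i + k - 1 = slot i" by (simp add: slot_def)
    moreover have "M' R_k = k" "M' R_p = p" "M' R_m = m" using inv params by simp_all
    ultimately show "wp read_student
        (timely (\<lambda>M'' inp'' out''. M'' R_student = i \<and> M'' R_m = M' R_m \<and>
          ?I (Suc i) (M''(R_student := Suc i)) inp'' out'') (u + 14)) M' inp' out' u"
      using inv counter student_below_Suc[OF \<open>i < m\<close>] by (simp add: read_student_def wp_simps fun_eq_iff)
  next
    fix M' inp' out' u
    assume "?I (M R_m) M' inp' out'" "u \<le> u\<^sub>0 + (14 + 2) * M R_m + 2"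
    then show "Q M' inp' out' u" using params(1) by (auto simp: student_below_m intro!: post)
  qed (use zero in \<open>simp_all add: student_below_def fun_eq_iff\<close>)
qed

definition loaded :: "memory \<Rightarrow> bool" where
  "loaded M \<longleftrightarrow> M R_m = m \<and> M R_p = p \<and> M R_k = k \<and>
     arr A_student M = student \<and> arr A_row M = (\<lambda>t. student t * p) \<and> (\<forall>q<p. arr A_rank M q = \<beta> q) \<and>
     (\<forall>s. \<forall>q<p. arr A_edge M (s * p + q) = of_bool ((s, q) \<in> E)) \<and>
     arr A_value M = (\<lambda>_. 0)"

lemma adjacency_row:
  assumes "q < p"
  shows "(if s * p + q < m * p then of_bool (((s * p + q) div p, (s * p + q) mod p) \<in> E) else 0) =
    (of_bool ((s, q) \<in> E) :: nat)"
proof (cases "s < m")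
  case True
  then have "Suc s * p \<le> m * p" by (intro mult_le_mono1) simp
  with assms show ?thesis by simp
next
  case False
  then have "m * p \<le> s * p" by simp
  with False show ?thesis using E_subset by auto
qed

lemma wp_read_input:
  assumes post: "\<And>M u. loaded M \<Longrightarrow> u \<le> 16 * m + 8 * p + 8 * (m * p) + 9 \<Longrightarrow> Q M [] [] u"
  shows "wp read_input Q (\<lambda>_. 0) (encode_input m p E \<alpha> \<beta> k) [] 0"
proof -
  let ?edge = "\<lambda>e. of_bool ((e div p, e mod p) \<in> E) :: nat"
  let ?M = "(\<lambda>_. 0)(R_m := m, R_p := p, R_k := k) :: memory"
  have zero: "arr a ?M = (\<lambda>_. 0)" for a by (simp add: arr_def fun_eq_iff)
  have "wp read_students (wp (read_array A_rank R_p) (wp (read_array A_edge R_row) Q)) ?M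
      (map \<alpha> [0..<m] @ map \<beta> [0..<p] @ map ?edge [0..<m * p] @ []) [] (0 + 1 + 1 + 1)"
  proof (rule wp_read_students)
    fix M\<^sub>1 u\<^sub>1
    assume students: "\<forall>r<32. r \<notin> {R_addr, R_index, R_row, R_student} \<longrightarrow> M\<^sub>1 r = ?M r" "M\<^sub>1 R_row = m * p"
      "\<forall>a<8. a \<notin> {A_student, A_row} \<longrightarrow> arr a M\<^sub>1 = arr a ?M" "arr A_student M\<^sub>1 = student"
      "arr A_row M\<^sub>1 = (\<lambda>t. student t * p)" "u\<^sub>1 \<le> 0 + 1 + 1 + 1 + 16 * m + 2"
    show "wp (read_array A_rank R_p) (wp (read_array A_edge R_row) Q) M\<^sub>1
      (map \<beta> [0..<p] @ map ?edge [0..<m * p] @ []) [] u\<^sub>1"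
    proof (rule wp_read_array)
      fix M\<^sub>2 u\<^sub>2
      assume ranks: "\<forall>r<32. r \<notin> {R_addr, R_q, R_edge} \<longrightarrow> M\<^sub>2 r = M\<^sub>1 r"
        "\<forall>a<8. a \<noteq> A_rank \<longrightarrow> arr a M\<^sub>2 = arr a M\<^sub>1"
        "arr A_rank M\<^sub>2 = (\<lambda>e. if e < p then \<beta> e else arr A_rank M\<^sub>1 e)" "u\<^sub>2 \<le> u\<^sub>1 + 8 * p + 2"
      show "wp (read_array A_edge R_row) Q M\<^sub>2 (map ?edge [0..<m * p] @ []) [] u\<^sub>2"
      proof (rule wp_read_array)
        fix M\<^sub>3 u\<^sub>3
        assume edges: "\<forall>r<32. r \<notin> {R_addr, R_q, R_edge} \<longrightarrow> M\<^sub>3 r = M\<^sub>2 r"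
          "\<forall>a<8. a \<noteq> A_edge \<longrightarrow> arr a M\<^sub>3 = arr a M\<^sub>2"
          "arr A_edge M\<^sub>3 = (\<lambda>e. if e < m * p then ?edge e else arr A_edge M\<^sub>2 e)"
          "u\<^sub>3 \<le> u\<^sub>2 + 8 * (m * p) + 2"
        have unset: "arr A_edge M\<^sub>2 = (\<lambda>_. 0)" using students ranks zero by simp
        have "arr A_edge M\<^sub>3 = (\<lambda>e. if e < m * p then ?edge e else 0)" using edges(3) unfolding unset .
        moreover have "arr A_rank M\<^sub>3 q = \<beta> q" if "q < p" for q using ranks(3) edges(2) that by simp
        ultimately have "loaded M\<^sub>3"
          using students ranks edges zero adjacency_row by (simp add: loaded_def)
        then show "Q M\<^sub>3 [] [] u\<^sub>3" using students ranks edges by (intro post) simp_all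
      qed (use students ranks in simp_all)
    qed (use students in simp_all)
  qed (simp_all add: zero)
  then show ?thesis
    by (simp add: read_input_def wp_simps encode_input_def concat_rows)
qed

end

section \<open>Initialising the table\<close>

definition multiply :: "nat \<Rightarrow> nat \<Rightarrow> nat \<Rightarrow> program" where
  "multiply r a l = block
     [Move (To_Cell r) (Const 0),
      for_up R_q l (Add (To_Cell r) (Cell r) (Cell a))]"

definition powers :: program where
  "powers = block
     [Move (To_Cell R_width) (Const 1),
      Move (To_Cell R_mask) (Const 1),
      for_up R_q R_k (block
        [Add (To_Cell R_width) (Cell R_width) (Cell R_width),
         Add (To_Cell R_width) (Cell R_width) (Cell R_width),
         Add (To_Cell R_mask) (Cell R_mask) (Cell R_mask)])]"

definition init_masks :: program where
  "init_masks = block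
     [powers,
      Sub (To_Cell R_mask) (Cell R_mask) (Const 1),
      Add (To_Cell R_slots) (Cell R_k) (Cell R_k),
      Add (To_Cell R_slots) (Cell R_slots) (Const 1)]"

definition init_nodes :: program where
  "init_nodes = block
     [Add (To_Cell R_index) (Cell R_p) (Const 2),
      multiply R_layer R_width R_index,
      Add (To_Cell R_i) (Cell R_m) (Const 1),
      multiply R_node R_layer R_i]"

definition mark_sink :: program where
  "mark_sink = block
     [Sub (To_Cell R_sink) (Cell R_node) (Cell R_width),
      Add (To_Cell R_sink) (Cell R_sink) (Cell R_mask),
      Move (To_Cell R_value) (Const 1),
      store A_value R_sink R_value]"

definition init_table :: program where
  "init_table = block [init_masks, init_nodes, mark_sink]"

lemma wp_multiply:
  assumes "distinct [r, a, l, R_q]" and limit: "M l = n"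
    and post: "\<And>u. u \<le> u\<^sub>0 + 3 * n + 3 \<Longrightarrow> Q (M(r := n * M a, R_q := n)) inp out u"
  shows "wp (multiply r a l) Q M inp out u\<^sub>0"
proof -
  let ?I = "\<lambda>i M' inp' out'. M' = M(r := i * M a, R_q := i) \<and> inp' = inp \<and> out' = out"
  have "wp (for_up R_q l (Add (To_Cell r) (Cell r) (Cell a))) Q (M(r := 0)) inp out (u\<^sub>0 + 1)"
  proof (rule wp_for_up[where c = 1 and I = ?I])
    fix i M' inp' out' u
    assume "?I i M' inp' out'"
    then show "wp (Add (To_Cell r) (Cell r) (Cell a)) (timely (\<lambda>M'' inp'' out''. M'' R_q = i \<and> M'' l = M' l \<and>
        ?I (Suc i) (M''(R_q := Suc i)) inp'' out'') (u + 1)) M' inp' out' u"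
      using assms(1) by (auto simp: wp_simps fun_eq_iff)
  qed (use assms(1) in \<open>auto simp: limit intro!: post\<close>)
  then show ?thesis by (simp add: multiply_def wp_simps)
qed

lemma wp_powers:
  assumes limit: "M R_k = n"
    and post: "\<And>u. u \<le> u\<^sub>0 + 5 * n + 4 \<Longrightarrow> Q (M(R_width := 2 ^ (2 * n), R_mask := 2 ^ n, R_q := n)) inp out u"
  shows "wp powers Q M inp out u\<^sub>0"
proof -
  let ?M = "M(R_width := 1, R_mask := 1)"
  let ?I = "\<lambda>i M' inp' out'. M' = M(R_width := 2 ^ (2 * i), R_mask := 2 ^ i, R_q := i) \<and>
    inp' = inp \<and> out' = out"
  let ?body = "block
    [Add (To_Cell R_width) (Cell R_width) (Cell R_width),
     Add (To_Cell R_width) (Cell R_width) (Cell R_width),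
     Add (To_Cell R_mask) (Cell R_mask) (Cell R_mask)]"
  have "wp (for_up R_q R_k ?body) Q ?M inp out (u\<^sub>0 + 2)"
  proof (rule wp_for_up[where c = 3 and I = ?I])
    fix i M' inp' out' u
    assume "?I i M' inp' out'"
    then show "wp ?body (timely (\<lambda>M'' inp'' out''. M'' R_q = i \<and> M'' R_k = M' R_k \<and>
        ?I (Suc i) (M''(R_q := Suc i)) inp'' out'') (u + 3)) M' inp' out' u"
      by (auto simp: wp_simps fun_eq_iff)
  qed (auto simp: limit intro!: post)
  then show ?thesis by (simp add: powers_def wp_simps)
qed

lemma wp_init_masks:
  assumes limit: "M R_k = n"
    and post: "\<And>u. u \<le> u\<^sub>0 + 5 * n + 7 \<Longrightarrow>
      Q (M(R_width := 2 ^ (2 * n), R_mask := mask n, R_q := n, R_slots := 2 * n + 1)) inp out u"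
  shows "wp init_masks Q M inp out u\<^sub>0"
  unfolding init_masks_def block.simps wp_Seq
proof (rule wp_powers[where n = n])
  fix u assume "u \<le> u\<^sub>0 + 5 * n + 4"
  then have "Q (M(R_width := 2 ^ (2 * n), R_mask := mask n, R_q := n, R_slots := 2 * n + 1)) inp out
      (u + 1 + 1 + 1)"
    by (intro post) simp
  then show "wp (Sub (To_Cell R_mask) (Cell R_mask) (Const 1))
     (wp (Add (To_Cell R_slots) (Cell R_k) (Cell R_k))
       (wp (Add (To_Cell R_slots) (Cell R_slots) (Const 1)) Q))
     (M(R_width := 2 ^ (2 * n), R_mask := 2 ^ n, R_q := n)) inp out u"
    using limit by (simp add: wp_simps mask_eq_exp_minus_1 mult_2 fun_upd_twist)
qed (rule limit)

lemma wp_init_nodes: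
  assumes params: "M R_m = m" "M R_p = p" "M R_width = w"
    and post: "\<And>u. u \<le> u\<^sub>0 + 3 * m + 3 * p + 17 \<Longrightarrow> Q (M(R_index := p + 2, R_layer := (p + 2) * w,
      R_i := m + 1, R_node := (m + 1) * ((p + 2) * w), R_q := m + 1)) inp out u"
  shows "wp init_nodes Q M inp out u\<^sub>0"
proof -
  let ?M = "M(R_index := p + 2)"
  let ?M' = "?M(R_layer := (p + 2) * w, R_q := p + 2, R_i := m + 1)"
  have "wp (multiply R_layer R_width R_index) (wp (Add (To_Cell R_i) (Cell R_m) (Const 1))
      (wp (multiply R_node R_layer R_i) Q)) ?M inp out (u\<^sub>0 + 1)"
  proof (rule wp_multiply[where n = "p + 2"])
    fix u assume time: "u \<le> u\<^sub>0 + 1 + 3 * (p + 2) + 3"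
    have "wp (multiply R_node R_layer R_i) Q ?M' inp out (u + 1)"
    proof (rule wp_multiply[where n = "m + 1"])
      fix u' assume "u' \<le> u + 1 + 3 * (m + 1) + 3"
      then have "u' \<le> u\<^sub>0 + 3 * m + 3 * p + 17" using time by simp
      from post[OF this] show "Q (?M'(R_node := (m + 1) * ?M' R_layer, R_q := m + 1)) inp out u'"
        by (simp add: fun_upd_twist)
    qed simp_all
    then show "wp (Add (To_Cell R_i) (Cell R_m) (Const 1)) (wp (multiply R_node R_layer R_i) Q)
        (?M(R_layer := (p + 2) * ?M R_width, R_q := p + 2)) inp out u"
      using params by (simp add: wp_simps)
  qed simp_all
  then show ?thesis using params by (simp add: init_nodes_def wp_simps)
qed

context near_chain
begin

lemma solved_initially:
  assumes "arr A_value M = (\<lambda>_. 0)(idx m (Suc p) (mask k) := 1)"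
  shows "solved (idx (Suc m) 0 0) M"
  unfolding solved_def
proof (intro allI impI)
  fix i j x :: nat assume bounds: "i \<le> Suc m" "j \<le> Suc p" "x < width"
  let ?first = "idx (Suc m) 0 0" and ?N = "idx i j x"
  show "(m < i \<or> p < j \<or> ?first \<le> ?N \<longrightarrow> value_stored i j x M) \<and>
    (i \<le> m \<and> j \<le> p \<and> ?first \<le> ?N \<longrightarrow> move_stored i j x M)"
  proof (cases "i \<le> m \<and> j \<le> p")
    case True
    then have "?N < ?first" using bounds by (simp add: idx_less_iff)
    then show ?thesis using True by simp
  next
    case False
    then have beyond: "i = Suc m \<or> j = Suc p" using bounds by auto
    have "?N = idx m (Suc p) (mask k) \<longleftrightarrow> i = m \<and> j = Suc p \<and> x = mask k"
      using bounds mask_less_width by (intro idx_eq_iff) auto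
    then show ?thesis
      using opt_beyond[OF beyond, of x] beyond by (auto simp: value_stored_def assms stored_zero)
  qed
qed

lemma wp_init_table:
  assumes loaded: "loaded M"
    and post: "\<And>M' u. swept (Suc m) 0 0 M' \<Longrightarrow> M' R_i = Suc m \<Longrightarrow> u \<le> u\<^sub>0 + 3 * m + 3 * p + 5 * k + 32 \<Longrightarrow>
      Q M' inp out u"
  shows "wp init_table Q M inp out u\<^sub>0"
  unfolding init_table_def block.simps wp_Seq
proof (rule wp_init_masks[where n = k])
  show "M R_k = k" using loaded by (simp add: loaded_def)
  fix u assume time: "u \<le> u\<^sub>0 + 5 * k + 7"
  let ?M = "M(R_width := 2 ^ (2 * k), R_mask := mask k, R_q := k, R_slots := 2 * k + 1)"
  show "wp init_nodes (wp mark_sink Q) ?M inp out u"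
  proof (rule wp_init_nodes[where m = m and p = p and w = width])
    fix u' assume time': "u' \<le> u + 3 * m + 3 * p + 17"
    let ?M' = "?M(R_index := p + 2, R_layer := (p + 2) * width, R_i := m + 1,
      R_node := (m + 1) * ((p + 2) * width), R_q := m + 1)"
    let ?sink = "idx m (Suc p) (mask k)"
    let ?M'' = "upd A_value ?sink 1 (?M'(R_sink := ?sink, R_value := 1, R_addr := 36 + 8 * ?sink))"
    have "(m + 1) * ((p + 2) * width) - width + mask k = ?sink"
      by (simp add: idx_def algebra_simps)
    moreover have "prepared ?M''" using loaded by (simp add: prepared_def loaded_def width_def)
    moreover have "solved (idx (Suc m) 0 0) ?M''"
      using loaded by (intro solved_initially) (simp add: loaded_def)
    moreover have "?M'' R_node = idx (Suc m) 0 0" by (simp add: idx_def algebra_simps)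
    ultimately have "Q ?M'' inp out (8 + u')"
      using time time' by (intro post) (simp_all add: swept_def)
    with \<open>_ = ?sink\<close> show "wp mark_sink Q ?M' inp out u'"
      by (simp add: mark_sink_def wp_simps fun_upd_twist width_def)
  qed (use loaded in \<open>simp_all add: loaded_def width_def\<close>)
qed

end

section \<open>The running time\<close>

lemma sixteen_power_le:
  assumes "0 < k"
  shows "(16::nat) ^ k \<le> 4096 * k ^ (2 * k)"
proof (cases "4 \<le> k")
  case True
  have "(16::nat) ^ k = 4 ^ (2 * k)" by (simp add: power_mult)
  also have "\<dots> \<le> k ^ (2 * k)" using True by (rule power_mono) simp
  finally show ?thesis by simp
next
  case False
  then have "(16::nat) ^ k \<le> 16 ^ 3" by (intro power_increasing) auto
  also have "\<dots> \<le> 4096 * k ^ (2 * k)" using assms by simp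
  finally show ?thesis .
qed

context near_chain
begin

definition prepare_time :: nat where
  "prepare_time = 19 * m + 11 * p + 8 * (m * p) + 5 * k + 41"

definition work :: nat where
  "work = (m + 1) * (p + 1) ^ 2 * k * width ^ 2"

lemma width_pos: "1 \<le> width"
  by (simp add: width_def)

lemma le_work: "(m + 1) * (p + 1) ^ 2 \<le> work" "k \<le> work" "1 \<le> work"
proof -
  have "(m + 1) * (p + 1) ^ 2 * 1 * 1 ^ 2 \<le> work" "1 * 1 ^ 2 * k * 1 ^ 2 \<le> work"
    unfolding work_def using k_pos width_pos by (intro mult_le_mono power_mono; simp)+
  then show "(m + 1) * (p + 1) ^ 2 \<le> work" "k \<le> work" by simp_all
  with k_pos show "1 \<le> work" by simp
qed

lemma node_time_le: "node_time \<le> 159 * (k * width * (p + 1))"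
proof -
  define c where "c = p + 1"
  have "1 \<le> c" "18 * p + 35 \<le> 35 * c" by (simp_all add: c_def)
  moreover have "width * 1 \<le> width * c" "1 * c \<le> width * c"
    using \<open>1 \<le> c\<close> width_pos by (intro mult_le_mono; simp)+
  ultimately have "slot_time + 2 \<le> 44 * (width * c)" unfolding slot_time_def by linarith
  then have "(2 * k + 1) * (slot_time + 2) \<le> 3 * k * (44 * (width * c))"
    using k_pos by (intro mult_le_mono) auto
  moreover have "1 * 1 * 1 \<le> k * width * c"
    using k_pos width_pos \<open>1 \<le> c\<close> by (intro mult_le_mono) auto
  ultimately have "node_time \<le> 159 * (k * width * c)" unfolding node_time_def by linarith
  then show ?thesis by (simp add: c_def)
qed

lemma level_time_le: "level_time \<le> 164 * (k * width ^ 2 * (p + 1))"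
proof -
  define u where "u = k * width * (p + 1)"
  have "1 * 1 * 1 \<le> u" unfolding u_def using k_pos width_pos by (intro mult_le_mono) auto
  moreover have "1 * 1 \<le> u * width" using \<open>1 * 1 * 1 \<le> u\<close> width_pos by (intro mult_le_mono) auto
  moreover have "(node_time + 3) * width \<le> 162 * u * width"
    using node_time_le \<open>1 * 1 * 1 \<le> u\<close> by (intro mult_le_mono1) (simp add: u_def)
  ultimately have "level_time \<le> 164 * (u * width)" unfolding level_time_def by linarith
  also have "u * width = k * width ^ 2 * (p + 1)" by (simp only: u_def power2_eq_square mult_ac)
  finally show ?thesis .
qed

lemma sweep_time_le: "sweep_time \<le> 172 * work"
proof -
  define v where "v = k * width ^ 2 * (p + 1)"
  have "1 * 1 ^ 2 * 1 \<le> v" unfolding v_def using k_pos width_pos by (intro mult_le_mono power_mono) auto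
  moreover have "1 * 1 \<le> v * (p + 1)" using \<open>1 * 1 ^ 2 * 1 \<le> v\<close> by (intro mult_le_mono) auto
  moreover have "(level_time + 2) * (p + 1) \<le> 166 * v * (p + 1)"
    using level_time_le \<open>1 * 1 ^ 2 * 1 \<le> v\<close> by (intro mult_le_mono1) (simp add: v_def)
  ultimately have "position_time + 2 \<le> 171 * (v * (p + 1))" unfolding position_time_def by linarith
  then have "(position_time + 2) * (m + 1) \<le> 171 * (v * (p + 1)) * (m + 1)" by (rule mult_le_mono1)
  also have "\<dots> = 171 * work" by (simp only: v_def work_def power2_eq_square mult_ac)
  finally show ?thesis using le_work(3) by (simp add: sweep_time_def)
qed

lemma trace_time_le: "trace_time \<le> 36 * work"
proof -
  have "trace_step_time + 1 \<le> 31 * (p + 1)" "m + p + 1 \<le> (m + 1) * (p + 1)"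
    by (simp_all add: trace_step_time_def)
  then have "(trace_step_time + 1) * (m + p + 1) \<le> 31 * (p + 1) * ((m + 1) * (p + 1))"
    by (rule mult_le_mono)
  also have "\<dots> = 31 * ((m + 1) * (p + 1) ^ 2)" by (simp only: power2_eq_square mult_ac)
  also have "\<dots> \<le> 31 * work" using le_work(1) by (rule mult_le_mono2)
  finally show ?thesis using le_work(3) unfolding trace_time_def by linarith
qed

lemma prepare_time_le: "prepare_time \<le> 65 * work"
proof -
  have "m + p + m * p + 1 \<le> (m + 1) * (p + 1) ^ 2" by (simp add: power2_eq_square algebra_simps)
  then have "m + p + m * p + 1 \<le> work" using le_work(1) by (rule order.trans)
  then show ?thesis using le_work(2,3) by (simp add: prepare_time_def)
qed

lemma work_le:
  assumes "0 < m + p"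
  shows "work \<le> 32768 * ((m + p) ^ 3 * k ^ (2 * k + 2))"
proof -
  define n where "n = m + p"
  have "m + 1 \<le> 2 * n" "p + 1 \<le> 2 * n" using assms by (auto simp: n_def)
  then have "(m + 1) * (p + 1) ^ 2 \<le> 2 * n * (2 * n) ^ 2"
    by (intro mult_le_mono power_mono) auto
  also have "\<dots> = 8 * n ^ 3" by (simp add: power3_eq_cube power2_eq_square)
  finally have nodes: "(m + 1) * (p + 1) ^ 2 \<le> 8 * n ^ 3" .
  have "width ^ 2 = 2 ^ (4 * k)" by (simp add: width_def flip: power_mult)
  also have "\<dots> = 16 ^ k" by (simp add: power_mult)
  finally have "k * width ^ 2 \<le> k * (4096 * k ^ (2 * k))" using sixteen_power_le[OF k_pos] by simp
  also have "\<dots> \<le> k ^ 2 * (4096 * k ^ (2 * k))"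
    using k_pos by (intro mult_le_mono1) (simp add: power2_eq_square)
  also have "\<dots> = 4096 * k ^ (2 * k + 2)" by (simp add: power_add power2_eq_square)
  finally have "k * width ^ 2 \<le> 4096 * k ^ (2 * k + 2)" .
  from mult_le_mono[OF nodes this] show ?thesis by (simp add: work_def n_def mult.assoc)
qed

definition solver_time :: nat where
  "solver_time = prepare_time + sweep_time + trace_time"

lemma solver_time_le:
  assumes "0 < m + p"
  shows "solver_time \<le> 273 * 32768 * ((m + p) ^ 3 * k ^ (2 * k + 2))"
proof -
  have "solver_time \<le> 273 * work"
    using prepare_time_le sweep_time_le trace_time_le by (simp add: solver_time_def)
  also have "\<dots> \<le> 273 * (32768 * ((m + p) ^ 3 * k ^ (2 * k + 2)))"
    using work_le[OF assms] by (rule mult_le_mono2)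
  finally show ?thesis by simp
qed

end

definition solver :: program where
  "solver = block [read_input, init_table, sweep, trace]"

context near_chain
begin

lemma wp_solver:
  "wp solver (\<lambda>M inp out t. \<exists>F. encodes_output out F \<and> near_chain_solution {..<m} {..<p} E \<alpha> \<beta> k F \<and>
      t \<le> solver_time) (\<lambda>_. 0) (encode_input m p E \<alpha> \<beta> k) [] 0" (is "wp solver ?Q _ _ _ _")
  unfolding solver_def block.simps wp_Seq
proof (rule wp_read_input)
  fix M u assume "loaded M" and read: "u \<le> 16 * m + 8 * p + 8 * (m * p) + 9"
  then show "wp init_table (wp sweep (wp trace ?Q)) M [] [] u"
  proof (elim wp_init_table)
    fix M u' assume "swept (Suc m) 0 0 M" "M R_i = Suc m"
      and init: "u' \<le> u + 3 * m + 3 * p + 5 * k + 32"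
    then show "wp sweep (wp trace ?Q) M [] [] u'"
    proof (elim wp_sweep)
      fix M u'' assume "swept 0 0 0 M" and sweep: "u'' \<le> u' + sweep_time"
      then show "wp trace ?Q M [] [] u''"
      proof (elim wp_trace)
        fix M t T assume trace: "t \<le> u'' + trace_time"
          and optimal: "completes 0 0 (mask k) T" "opt 0 0 (mask k) = enat (total T)"
        have "encodes_output (flatten (edits T)) (set (edits T))"
          using optimal_schedule_imp_solution(2)[OF optimal] by (auto simp: encodes_output_def flatten_def)
        moreover have "t \<le> solver_time"
          using read init sweep trace by (simp add: solver_time_def prepare_time_def)
        ultimately show "?Q M [] (flatten (edits T)) t"
          using optimal_schedule_imp_solution(1)[OF optimal] by blast
      qed
    qed
  qed
qed

lemma runs_solver:
  obtains t out F where "runs solver (encode_input m p E \<alpha> \<beta> k) t out" "encodes_output out F"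
    "near_chain_solution {..<m} {..<p} E \<alpha> \<beta> k F" "t \<le> solver_time"
  using wp_solver unfolding wp_def runs_def add_0 by blast

end

theorem theorem1:
  shows "\<exists>(P :: program) (C :: nat).
    \<forall>(m :: nat) (p :: nat) (E :: (nat \<times> nat) set) (\<alpha> :: nat \<Rightarrow> nat) (\<beta> :: nat \<Rightarrow> nat) (k :: nat).
      near_chain_instance {..<m} {..<p} E \<alpha> \<beta> k \<longrightarrow>
      (\<exists>t out F.
         runs P (encode_input m p E \<alpha> \<beta> k) t out \<and>
         encodes_output out F \<and>
         near_chain_solution {..<m} {..<p} E \<alpha> \<beta> k F \<and>
         (m + p > 0 \<longrightarrow> t \<le> C * ((m + p) ^ 3 * k ^ (2 * k + 2))))"
proof (rule exI[of _ solver], rule exI[of _ "273 * 32768"], intro allI impI)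
  fix m p k :: nat and E :: "(nat \<times> nat) set" and \<alpha> \<beta> :: "nat \<Rightarrow> nat"
  assume "near_chain_instance {..<m} {..<p} E \<alpha> \<beta> k"
  then interpret near_chain m p k E \<alpha> \<beta> by unfold_locales
  obtain t out F where "runs solver (encode_input m p E \<alpha> \<beta> k) t out" "encodes_output out F"
    "near_chain_solution {..<m} {..<p} E \<alpha> \<beta> k F" "t \<le> solver_time"
    by (rule runs_solver)
  with solver_time_le show "\<exists>t out F.
         runs solver (encode_input m p E \<alpha> \<beta> k) t out \<and>
         encodes_output out F \<and>
         near_chain_solution {..<m} {..<p} E \<alpha> \<beta> k F \<and>
         (m + p > 0 \<longrightarrow> t \<le> 273 * 32768 * ((m + p) ^ 3 * k ^ (2 * k + 2)))"
    by (blast intro: order.trans)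
qed

end
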